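(* Let $\Omega \subset \mathbb{R}^d$ be open and bounded. Let $T$ be a bounded operator on $L_2(\Omega)$ which is positive and suppose that $T L_2(\Omega) \subset C(\overline{\Omega})$. Then for all $\varepsilon > 0$ there exists a $K \in C(\overline{\Omega} \times \overline{\Omega})$ such that $$(T^{2+\varepsilon} u)(x) = \int_\Omega K(x,y)\, u(y)\, dy$$ for all $u \in L_2(\Omega)$ and $x \in \overline{\Omega}$.
   Context: $L_2(\Omega)$ is the complex Hilbert space of (classes of) square-integrable functions on $\Omega$ with Lebesgue measure, and $C(\overline{\Omega})$ is the space of complex-valued continuous functions on $\overline{\Omega}$. "Positive" is meant in the Hilbert space sense: $T$ is self-adjoint and $(Tu,u)_{L_2(\Omega)} \ge 0$ for all $u \in L_2(\Omega)$. The powers $T^{\alpha}$, $\alpha > 0$, are defined by the functional calculus for positive self-adjoint operators. The inclusion $T L_2(\Omega) \subset C(\overline{\Omega})$ means that for every $u \in L_2(\Omega)$ the element $Tu$ has a representative on $\Omega$ which extends to a (necessarily unique) continuous function on $\overline{\Omega}$; $Tu$ is identified with this continuous function, so that $(Tu)(x)$ is defined for every $x \in \overline{\Omega}$. The same convention applies to $T^{2+\varepsilon} u$. *)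

theory Defs
  imports "HOL-Analysis.Analysis" "HOL-Computational_Algebra.Polynomial"
begin

text \<open>
  The elements of the complex Hilbert space \<open>L\<^sub>2(\<Omega>)\<close> are given by representatives: functions whose
  restriction to \<open>\<Omega>\<close> is Lebesgue measurable and square-integrable, with almost everywhere equality
  on \<open>\<Omega>\<close> in the role of equality. Nothing below depends on their values outside \<open>\<Omega>\<close>.
\<close>

definition L2 :: "'a::euclidean_space set \<Rightarrow> ('a \<Rightarrow> complex) set" where
  "L2 \<Omega> = {u \<in> borel_measurable (lebesgue_on \<Omega>). integrable (lebesgue_on \<Omega>) (\<lambda>x. (cmod (u x))\<^sup>2)}"

definition ae_eq :: "'a::euclidean_space set \<Rightarrow> ('a \<Rightarrow> complex) \<Rightarrow> ('a \<Rightarrow> complex) \<Rightarrow> bool" where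
  "ae_eq \<Omega> u v \<longleftrightarrow> (AE x in lebesgue_on \<Omega>. u x = v x)"

definition l2_inner :: "'a::euclidean_space set \<Rightarrow> ('a \<Rightarrow> complex) \<Rightarrow> ('a \<Rightarrow> complex) \<Rightarrow> complex" where
  "l2_inner \<Omega> u v = (LINT x|lebesgue_on \<Omega>. u x * cnj (v x))"

definition l2_norm :: "'a::euclidean_space set \<Rightarrow> ('a \<Rightarrow> complex) \<Rightarrow> real" where
  "l2_norm \<Omega> u = sqrt (LINT x|lebesgue_on \<Omega>. (cmod (u x))\<^sup>2)"

text \<open>An operator on \<open>L\<^sub>2(\<Omega>)\<close> is a map on representatives that is compatible with almost everywhere
  equality, i.e. that induces a map on classes.\<close>

type_synonym 'a oper = "('a \<Rightarrow> complex) \<Rightarrow> ('a \<Rightarrow> complex)"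

definition bounded_op :: "'a::euclidean_space set \<Rightarrow> 'a oper \<Rightarrow> bool" where
  "bounded_op \<Omega> T \<longleftrightarrow>
     (\<forall>u\<in>L2 \<Omega>. T u \<in> L2 \<Omega>) \<and>
     (\<forall>u\<in>L2 \<Omega>. \<forall>v\<in>L2 \<Omega>. ae_eq \<Omega> u v \<longrightarrow> ae_eq \<Omega> (T u) (T v)) \<and>
     (\<forall>u\<in>L2 \<Omega>. \<forall>v\<in>L2 \<Omega>. ae_eq \<Omega> (T (\<lambda>x. u x + v x)) (\<lambda>x. T u x + T v x)) \<and>
     (\<forall>u\<in>L2 \<Omega>. \<forall>c. ae_eq \<Omega> (T (\<lambda>x. c * u x)) (\<lambda>x. c * T u x)) \<and>
     (\<exists>C. \<forall>u\<in>L2 \<Omega>. l2_norm \<Omega> (T u) \<le> C * l2_norm \<Omega> u)"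

definition self_adjoint_op :: "'a::euclidean_space set \<Rightarrow> 'a oper \<Rightarrow> bool" where
  "self_adjoint_op \<Omega> T \<longleftrightarrow> (\<forall>u\<in>L2 \<Omega>. \<forall>v\<in>L2 \<Omega>. l2_inner \<Omega> (T u) v = l2_inner \<Omega> u (T v))"

definition positive_op :: "'a::euclidean_space set \<Rightarrow> 'a oper \<Rightarrow> bool" where
  "positive_op \<Omega> T \<longleftrightarrow>
     self_adjoint_op \<Omega> T \<and> (\<forall>u\<in>L2 \<Omega>. l2_inner \<Omega> (T u) u \<in> \<real>\<^sub>\<ge>\<^sub>0)"

definition op_norm :: "'a::euclidean_space set \<Rightarrow> 'a oper \<Rightarrow> real" where
  "op_norm \<Omega> T = Inf {C. 0 \<le> C \<and> (\<forall>u\<in>L2 \<Omega>. l2_norm \<Omega> (T u) \<le> C * l2_norm \<Omega> u)}"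

definition op_spectrum :: "'a::euclidean_space set \<Rightarrow> 'a oper \<Rightarrow> complex set" where
  "op_spectrum \<Omega> T = {z. \<not> (\<exists>R. bounded_op \<Omega> R \<and>
     (\<forall>u\<in>L2 \<Omega>. ae_eq \<Omega> (R (\<lambda>x. T u x - z * u x)) u \<and>
                ae_eq \<Omega> (\<lambda>x. T (R u) x - z * R u x) u))}"

definition poly_op :: "complex poly \<Rightarrow> 'a oper \<Rightarrow> 'a oper" where
  "poly_op p T u = (\<lambda>x. \<Sum>i\<le>degree p. coeff p i * (T ^^ i) u x)"

text \<open>
  The continuous functional calculus of a self-adjoint bounded operator \<open>T\<close>: the operator \<open>f(T)\<close> is
  the limit in operator norm of \<open>p\<^sub>n(T)\<close>, where the polynomials \<open>p\<^sub>n\<close> converge to \<open>f\<close> uniformly on the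
  spectrum of \<open>T\<close>. For \<open>f\<close> continuous on the spectrum this limit exists and depends, as an operator
  on classes, only on \<open>f\<close>; the choice in \<open>fun_calc\<close> is therefore one between representatives of the
  same operator.
\<close>

definition is_fun_calc ::
  "'a::euclidean_space set \<Rightarrow> 'a oper \<Rightarrow> (complex \<Rightarrow> complex) \<Rightarrow> 'a oper \<Rightarrow> bool" where
  "is_fun_calc \<Omega> T f S \<longleftrightarrow> bounded_op \<Omega> S \<and>
     (\<exists>p :: nat \<Rightarrow> complex poly.
        uniform_limit (op_spectrum \<Omega> T) (\<lambda>n. poly (p n)) f sequentially \<and>
        (\<lambda>n. op_norm \<Omega> (\<lambda>u x. poly_op (p n) T u x - S u x)) \<longlonglongrightarrow> 0)"

definition fun_calc :: "'a::euclidean_space set \<Rightarrow> 'a oper \<Rightarrow> (complex \<Rightarrow> complex) \<Rightarrow> 'a oper" where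
  "fun_calc \<Omega> T f = (SOME S. is_fun_calc \<Omega> T f S)"

text \<open>The spectrum of a positive operator is a subset of \<open>[0, \<infinity>)\<close>, where \<open>\<lambda>z. Re z powr \<alpha>\<close> is
  \<open>t \<mapsto> t\<^sup>\<alpha>\<close>, including the value \<open>0\<close> at \<open>0\<close>.\<close>

definition op_powr :: "'a::euclidean_space set \<Rightarrow> 'a oper \<Rightarrow> real \<Rightarrow> 'a oper" where
  "op_powr \<Omega> T \<alpha> = fun_calc \<Omega> T (\<lambda>z. complex_of_real (Re z powr \<alpha>))"

definition is_cont_rep :: "'a::euclidean_space set \<Rightarrow> ('a \<Rightarrow> complex) \<Rightarrow> ('a \<Rightarrow> complex) \<Rightarrow> bool" where
  "is_cont_rep \<Omega> u g \<longleftrightarrow> continuous_on (closure \<Omega>) g \<and> ae_eq \<Omega> u g"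

text \<open>Membership of (the class of) \<open>u\<close> in \<open>C(closure \<Omega>)\<close>.\<close>

definition in_C :: "'a::euclidean_space set \<Rightarrow> ('a \<Rightarrow> complex) \<Rightarrow> bool" where
  "in_C \<Omega> u \<longleftrightarrow> (\<exists>g. is_cont_rep \<Omega> u g)"

text \<open>For open \<open>\<Omega>\<close> the values of \<open>cont_rep \<Omega> u\<close> on \<open>closure \<Omega>\<close> do not depend on the choice; see
  \<open>is_cont_rep_unique\<close>.\<close>

definition cont_rep :: "'a::euclidean_space set \<Rightarrow> ('a \<Rightarrow> complex) \<Rightarrow> 'a \<Rightarrow> complex" where
  "cont_rep \<Omega> u = (SOME g. is_cont_rep \<Omega> u g)"

lemma is_cont_rep_unique:
  fixes \<Omega> :: "'a::euclidean_space set"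
  assumes "open \<Omega>" and g: "is_cont_rep \<Omega> u g" and h: "is_cont_rep \<Omega> u h" and x: "x \<in> closure \<Omega>"
  shows "g x = h x"
proof -
  have cg: "continuous_on (closure \<Omega>) (\<lambda>x. g x - h x)"
    using g h by (auto simp: is_cont_rep_def intro: continuous_intros)
  define N where "N = {x\<in>\<Omega>. g x - h x \<noteq> 0}"
  have "continuous_on \<Omega> (\<lambda>x. g x - h x)"
    using cg closure_subset continuous_on_subset by blast
  then have "open (\<Omega> \<inter> (\<lambda>x. g x - h x) -` (- {0}))"
    using assms(1) by (intro continuous_open_preimage) auto
  moreover have "\<Omega> \<inter> (\<lambda>x. g x - h x) -` (- {0}) = N" by (auto simp: N_def)
  ultimately have oN: "open N" by simp
  have "AE x in lebesgue_on \<Omega>. u x = g x" "AE x in lebesgue_on \<Omega>. u x = h x"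
    using g h by (auto simp: is_cont_rep_def ae_eq_def)
  then have "AE x in lebesgue_on \<Omega>. g x - h x = 0" by eventually_elim simp
  then have "AE x in lebesgue. x \<in> \<Omega> \<longrightarrow> g x - h x = 0"
    using assms(1) by (simp add: AE_restrict_space_iff)
  then have "AE x in lebesgue. x \<notin> N" by eventually_elim (auto simp: N_def)
  moreover have "N \<in> sets lebesgue" using oN by simp
  ultimately have "N \<in> null_sets lebesgue" by (simp add: AE_iff_null_sets)
  then have "N = {}" using oN open_not_negligible negligible_iff_null_sets by blast
  then have "\<And>y. y \<in> \<Omega> \<Longrightarrow> g y - h y = 0" by (auto simp: N_def)
  then have "g x - h x = 0" using continuous_constant_on_closure[OF cg _ x] by blast
  then show ?thesis by simp
qed

end

theory Submission
  imports Defs "HOL-Computational_Algebra.Fundamental_Theorem_Algebra"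
begin

text \<open>
  The values \<open>(T u)(x)\<close> are bounded linear functionals of \<open>u\<close>, uniformly in \<open>x\<close>, so
  \<open>(T u)(x) = (u, k\<^sub>x)\<close> with a bounded and weakly continuous family \<open>k\<^sub>x\<close>. Since
  \<open>(T k\<^sub>x)(y) = (k\<^sub>x, k\<^sub>y)\<close> and \<open>\<Omega>\<close> has finite measure, dominated convergence makes \<open>x \<mapsto> T k\<^sub>x\<close>
  norm continuous. The operator \<open>T\<^sup>\<epsilon>\<close> is a norm limit of polynomials in \<open>T\<close> without constant term,
  so \<open>x \<mapsto> T\<^sup>\<epsilon> k\<^sub>x\<close> is norm continuous as well, and
  \<open>(T T\<^sup>\<epsilon> T u)(x) = (T\<^sup>\<epsilon> T u, k\<^sub>x) = (u, T T\<^sup>\<epsilon> k\<^sub>x)\<close> exhibits the continuous kernel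
  \<open>K(x, y) = (k\<^sub>y, T\<^sup>\<epsilon> k\<^sub>x)\<close>. To identify \<open>T T\<^sup>\<epsilon> T\<close> with the functional calculus one needs that
  \<open>p(T)\<close> is bounded by the supremum of \<open>|p|\<close> over the spectrum.

  The square-integrable functions on the whole space form a Hilbert space type; those on \<open>\<Omega>\<close> are
  the subspace of functions vanishing outside \<open>\<Omega>\<close>, to which \<open>T\<close> is extended by zero. As this
  may add \<open>0\<close> to the spectrum, the spectral estimates are formulated on an invariant subspace.
\<close>

section \<open>Complex Hilbert spaces\<close>

text \<open>The exponent is spent as 1 + \<epsilon> + 1. The two factors \<open>T\<close> account
  for the points x and y; on their own they give the kernel (k_y, k_x), which is continuous in each
  variable separately, and weak continuity of k_x does not make it jointly continuous. The factor
  T^\<epsilon>, however small \<epsilon> is, supplies norm continuity in x, and the uniform bound on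
  point evaluations then handles both variables together. A constant term in an approximating
  polynomial would leave a multiple of k_x itself, for which only weak continuity is known; it can
  be removed because t^\<epsilon> vanishes at 0.

  The delicate point is that \<open>op_powr\<close> is chosen among operators approximated by
  polynomials whose convergence is known on the spectrum only. A norm estimate over an interval
  [0, M] is enough to construct T^\<epsilon>, but the comparison of the chosen operator with the
  constructed one needs the supremum over the spectrum itself. That estimate is obtained
  algebraically, by factoring complex polynomials.\<close>

lemma riesz_real:
  fixes f :: "'h::{real_inner,banach} \<Rightarrow> real"
  assumes "bounded_linear f"
  obtains k where "\<And>u. f u = inner u k"
proof -
  interpret f: bounded_linear f by fact
  obtain B where B: "\<And>u. \<bar>f u\<bar> \<le> norm u * B" using f.bounded by (auto simp: real_norm_def)
  \<comment> \<open>If f is the inner product with k, then \<open>E u\<close> is |u - k|^2 - |k|^2;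
    the vector sought is therefore found as a minimiser of \<open>E\<close>.\<close>
  define E where "E = (\<lambda>u. (norm u)\<^sup>2 - 2 * f u)"
  have lower: "- B\<^sup>2 \<le> E u" for u
  proof -
    have "0 \<le> (norm u - B)\<^sup>2" by simp
    moreover have "f u \<le> norm u * B" using B[of u] by linarith
    ultimately show ?thesis by (simp add: E_def power2_diff)
  qed
  define m where "m = Inf (range E)"
  have bdd: "bdd_below (range E)" using lower by (auto intro!: bdd_belowI[of _ "- B\<^sup>2"])
  have m_le: "m \<le> E u" for u unfolding m_def using bdd by (intro cInf_lower) auto
  have "\<exists>u. E u < m + e" if "0 < e" for e
    using cInf_lessD[of "range E" "m + e"] that by (auto simp: m_def)
  then have "\<forall>n. \<exists>u. E u < m + 1 / real (Suc n)" by simp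
  then obtain X where X: "\<And>n. E (X n) < m + 1 / real (Suc n)" by metis
  \<comment> \<open>The parallelogram law; the linear part of \<open>E\<close> cancels. It makes
    every minimising sequence Cauchy, since the midpoint cannot lie below the infimum
    \<open>m\<close>.\<close>
  have par: "(norm (u - v))\<^sup>2 = 2 * E u + 2 * E v - 4 * E ((1/2) *\<^sub>R (u + v))" for u v
    by (simp add: E_def f.add f.scaleR power2_norm_eq_inner algebra_simps inner_commute)
  have close: "(norm (X i - X j))\<^sup>2 \<le> 2 * (1 / real (Suc i) + 1 / real (Suc j))" for i j
    using X[of i] X[of j] m_le[of "(1/2) *\<^sub>R (X i + X j)"] unfolding par by argo
  have "Cauchy X"
  proof (rule metric_CauchyI)
    fix e :: real assume "0 < e"
    obtain N where N: "1 / real (Suc N) < e\<^sup>2 / 4"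
      using \<open>0 < e\<close> nat_approx_posE[of "e\<^sup>2 / 4"] by auto
    have "dist (X i) (X j) < e" if "i \<ge> N" "j \<ge> N" for i j
    proof -
      have "1 / real (Suc i) \<le> 1 / real (Suc N)" "1 / real (Suc j) \<le> 1 / real (Suc N)"
        using that by (auto simp: field_simps)
      then have "2 * (1 / real (Suc i) + 1 / real (Suc j)) \<le> 4 * (1 / real (Suc N))"
        by argo
      also have "\<dots> < e\<^sup>2" using N by argo
      finally have "(norm (X i - X j))\<^sup>2 < e\<^sup>2" using close[of i j] by (rule le_less_trans[rotated])
      then show ?thesis using \<open>0 < e\<close> by (simp add: dist_norm power2_less_imp_less)
    qed
    then show "\<exists>N. \<forall>i\<ge>N. \<forall>j\<ge>N. dist (X i) (X j) < e" by blast
  qed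
  then obtain k where k: "X \<longlonglongrightarrow> k" using Cauchy_convergent convergent_def by blast
  have lim1: "(\<lambda>n. E (X n)) \<longlonglongrightarrow> E k" unfolding E_def by (intro tendsto_intros f.tendsto k)
  have "(\<lambda>n. m + 1 / real (Suc n)) \<longlonglongrightarrow> m + 0"
    by (intro tendsto_intros LIMSEQ_Suc lim_1_over_n)
  then have "E k \<le> m" using lim1 X by (intro LIMSEQ_le[OF lim1]) (auto intro: less_imp_le)
  then have min: "E k \<le> E u" for u using m_le[of u] by linarith
  have "f u = inner u k" for u
  proof (cases "u = 0")
    case False
    define d where "d = f u - inner u k"
    \<comment> \<open>This \<open>t\<close> minimises the quadratic t^2 |u|^2 - 2 t d, so a nonzero
      \<open>d\<close> would push \<open>E\<close> below its minimum.\<close>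
    define t where "t = d / (norm u)\<^sup>2"
    have "E (k + t *\<^sub>R u) = E k + t\<^sup>2 * (norm u)\<^sup>2 - 2 * t * d"
      unfolding E_def power2_norm_eq_inner d_def f.add f.scaleR
      by (simp add: algebra_simps inner_commute power2_eq_square)
    also have "\<dots> = E k - d\<^sup>2 / (norm u)\<^sup>2"
      using False by (simp add: t_def power2_eq_square)
    finally have "d\<^sup>2 / (norm u)\<^sup>2 \<le> 0" using min[of "k + t *\<^sub>R u"] by simp
    then have "d = 0" using False by (simp add: divide_le_0_iff)
    then show ?thesis by (simp add: d_def)
  qed (simp add: f.zero)
  then show ?thesis by (rule that)
qed

text \<open>Baire category: one of the closed sets \<open>E n\<close> contains a ball around some a.
  Comparing the functional of w at a and at the point of that ball in direction w bounds r |w| by 2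
  n.\<close>

lemma uniform_boundedness_inner:
  fixes W :: "'h::{real_inner,banach} set"
  assumes bdd: "\<And>u. \<exists>B. \<forall>w\<in>W. \<bar>inner u w\<bar> \<le> B"
  shows "\<exists>C. \<forall>w\<in>W. norm w \<le> C"
proof -
  define E where "E n = {u. \<forall>w\<in>W. \<bar>inner u w\<bar> \<le> real n}" for n :: nat
  have closed: "closed (E n)" for n
  proof -
    have "E n = (\<Inter>w\<in>W. {u. \<bar>inner u w\<bar> \<le> real n})" by (auto simp: E_def)
    then show ?thesis by (auto intro!: closed_INT closed_Collect_le continuous_intros)
  qed
  have cover: "(\<Union>n. E n) = UNIV"
  proof -
    have "\<exists>n. u \<in> E n" for u
    proof -
      obtain B where "\<forall>w\<in>W. \<bar>inner u w\<bar> \<le> B" using bdd by blast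
      moreover obtain n where "B \<le> real n" using real_arch_simple by blast
      ultimately have "u \<in> E n" by (auto simp: E_def intro: order_trans)
      then show ?thesis ..
    qed
    then show ?thesis by blast
  qed
  have "\<exists>n. interior (E n) \<noteq> {}"
  proof (rule ccontr)
    assume "\<not> ?thesis"
    then have "Met_TC.mtopology interior_of \<Union> (range E) = {}"
      using closed by (intro Met_TC.metric_Baire_category_alt) (auto simp: complete_UNIV)
    then show False using cover by simp
  qed
  then obtain n a where "a \<in> interior (E n)" by blast
  then obtain r where r: "0 < r" "cball a r \<subseteq> E n"
    using interior_subset open_contains_cball open_interior by (metis order_trans)
  have "norm w \<le> 2 * real n / r" if w: "w \<in> W" for w
  proof (cases "w = 0")
    case False
    have "a \<in> E n" "a + (r / norm w) *\<^sub>R w \<in> E n"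
      using r False by (auto intro!: subsetD[OF r(2)] simp: dist_norm)
    then have "\<bar>inner a w\<bar> \<le> real n" "\<bar>inner a w + r / norm w * inner w w\<bar> \<le> real n"
      using w by (auto simp: E_def inner_add_left)
    then have "r / norm w * inner w w \<le> 2 * real n" by linarith
    moreover have "r / norm w * inner w w = r * norm w"
      using False by (simp add: power2_norm_eq_inner[symmetric] power2_eq_square)
    ultimately show ?thesis using r by (simp add: field_simps)
  qed (use r in auto)
  then show ?thesis by blast
qed

text \<open>A complex Hilbert space, encoded as a real one with an orthogonal map \<open>J\<close>
  of square -1 as multiplication by the imaginary unit; thus the real type classes and their limit
  theory apply unchanged.\<close>

locale complex_hilbert =
  fixes J :: "'h::{real_inner,banach} \<Rightarrow> 'h"
  assumes linear_J: "linear J"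
    and J_J [simp]: "J (J u) = - u"
    and inner_J_J [simp]: "inner (J u) (J v) = inner u v"
begin

lemma J_add [simp]: "J (u + v) = J u + J v"
  and J_scaleR [simp]: "J (r *\<^sub>R u) = r *\<^sub>R J u"
  and J_minus [simp]: "J (- u) = - J u"
  and J_diff [simp]: "J (u - v) = J u - J v"
  and J_zero [simp]: "J 0 = 0"
  using linear_J by (auto simp: linear_add linear_scale linear_neg linear_diff linear_0)

lemma inner_J_left: "inner (J u) v = - inner u (J v)"
  using inner_J_J[of u "J v"] by simp

lemma inner_J_self [simp]: "inner u (J u) = 0" "inner (J u) u = 0"
  using inner_J_left[of u u] by (simp_all add: inner_commute)

lemma norm_J [simp]: "norm (J u) = norm u"
  by (simp add: norm_eq_sqrt_inner)

definition cscale :: "complex \<Rightarrow> 'h \<Rightarrow> 'h" where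
  "cscale z u = Re z *\<^sub>R u + Im z *\<^sub>R J u"

text \<open>The complex inner product recovered from its real part through Im (u, v) = Re (u, i v);
  it is linear in the first and conjugate linear in the second argument.\<close>

definition cinner :: "'h \<Rightarrow> 'h \<Rightarrow> complex" where
  "cinner u v = Complex (inner u v) (inner u (J v))"

definition clinear :: "('h \<Rightarrow> 'h) \<Rightarrow> bool" where
  "clinear A \<longleftrightarrow> bounded_linear A \<and> (\<forall>u. A (J u) = J (A u))"

lemma cscale_simps [simp]:
  "cscale 0 u = 0" "cscale z 0 = 0" "cscale 1 u = u" "cscale (of_real r) u = r *\<^sub>R u"
  "cscale \<i> u = J u"
  by (auto simp: cscale_def)

lemma cscale_algebra:
  "cscale z (u + v) = cscale z u + cscale z v" "cscale z (u - v) = cscale z u - cscale z v"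
  "cscale (z + w) u = cscale z u + cscale w u" "cscale (z - w) u = cscale z u - cscale w u"
  "cscale z (cscale w u) = cscale (z * w) u" "cscale (- z) u = - cscale z u"
  "cscale z (r *\<^sub>R u) = r *\<^sub>R cscale z u" "cscale z (J u) = J (cscale z u)"
  "cscale z (- u) = - cscale z u"
  by (simp_all add: cscale_def algebra_simps)

lemma cscale_sum: "cscale z (sum f S) = (\<Sum>i\<in>S. cscale z (f i))"
  by (induction S rule: infinite_finite_induct) (auto simp: cscale_algebra)

lemma norm_cscale [simp]: "norm (cscale z u) = cmod z * norm u"
proof -
  have "(norm (cscale z u))\<^sup>2 = (cmod z * norm u)\<^sup>2"
    unfolding power2_norm_eq_inner power_mult_distrib cmod_power2
    by (simp add: cscale_def algebra_simps power2_eq_square inner_complex_def)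
  then show ?thesis by (simp add: power2_eq_iff_nonneg)
qed

lemma inner_cscale_left: "inner (cscale z u) v = inner u (cscale (cnj z) v)"
  by (simp add: cscale_def inner_J_left algebra_simps)

lemma clinear_cscale_fun: "clinear (cscale z)"
  unfolding clinear_def
  by (auto simp: cscale_algebra intro!: bounded_linear_intro[where K = "cmod z"])

lemma clinear_compose: "clinear A \<Longrightarrow> clinear B \<Longrightarrow> clinear (\<lambda>u. A (B u))"
  by (simp add: clinear_def bounded_linear_compose)

lemma clinear_add: "clinear A \<Longrightarrow> clinear B \<Longrightarrow> clinear (\<lambda>u. A u + B u)"
  by (simp add: clinear_def bounded_linear_add)

lemma clinear_diff: "clinear A \<Longrightarrow> clinear B \<Longrightarrow> clinear (\<lambda>u. A u - B u)"
  by (simp add: clinear_def bounded_linear_sub)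

lemma clinearD:
  assumes "clinear A"
  shows "A (u + v) = A u + A v" "A (u - v) = A u - A v" "A (r *\<^sub>R u) = r *\<^sub>R A u"
    "A (J u) = J (A u)" "A (cscale z u) = cscale z (A u)" "A 0 = 0" "bounded_linear A"
    "A (- u) = - A u"
proof -
  interpret bounded_linear A using assms by (simp add: clinear_def)
  show "A (u + v) = A u + A v" "A (u - v) = A u - A v" "A (r *\<^sub>R u) = r *\<^sub>R A u"
    "A (J u) = J (A u)" "A (cscale z u) = cscale z (A u)" "A 0 = 0" "bounded_linear A"
     "A (- u) = - A u"
    using assms by (simp_all add: clinear_def cscale_def add diff scaleR zero neg)
qed

lemma cinner_algebra:
  "cinner (u + v) w = cinner u w + cinner v w" "cinner (u - v) w = cinner u w - cinner v w"
  "cinner w (u + v) = cinner w u + cinner w v" "cinner w (u - v) = cinner w u - cinner w v"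
  by (simp_all add: cinner_def complex_eq_iff algebra_simps)

lemma cinner_cscale_left: "cinner (cscale z u) v = z * cinner u v"
  by (simp add: cinner_def cscale_def complex_eq_iff algebra_simps inner_J_left)

lemma cinner_commute: "cinner v u = cnj (cinner u v)"
  by (simp add: cinner_def complex_eq_iff inner_commute[of v u] inner_commute[of v "J u"] inner_J_left)

text \<open>A complex linear functional is determined by its real part, Im (f u) = - Re (f (i u)),
  so the real representing vector also represents f.\<close>

lemma riesz:
  assumes "\<And>u v. f (u + v) = f u + f v" "\<And>z u. f (cscale z u) = z * f u"
    and B: "\<And>u. cmod (f u) \<le> B * norm u"
  obtains k where "\<And>u. f u = cinner u k"
proof -
  have "bounded_linear (\<lambda>u. Re (f u))"
  proof (rule bounded_linear_intro[where K = B])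
    fix r u
    show "Re (f (r *\<^sub>R u)) = r *\<^sub>R Re (f u)" using assms(2)[of "of_real r" u] by simp
  next
    fix u
    show "norm (Re (f u)) \<le> norm u * B"
      using B[of u] abs_Re_le_cmod[of "f u"] by (simp add: mult.commute)
  qed (simp add: assms(1))
  then obtain k where k: "\<And>u. Re (f u) = inner u k" using riesz_real by blast
  have "f u = cinner u k" for u
  proof -
    have "Im (f u) = - Re (f (J u))" using assms(2)[of \<i> u] by simp
    then show ?thesis using k[of u] k[of "J u"] by (simp add: cinner_def complex_eq_iff inner_J_left)
  qed
  then show ?thesis by (rule that)
qed

end

section \<open>Polynomials of an operator\<close>

context complex_hilbert
begin

definition polyop :: "complex poly \<Rightarrow> ('h \<Rightarrow> 'h) \<Rightarrow> 'h \<Rightarrow> 'h" where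
  "polyop p T u = (\<Sum>i\<le>degree p. cscale (coeff p i) ((T ^^ i) u))"

lemma polyop_eq_sum:
  assumes "degree p \<le> n"
  shows "polyop p T u = (\<Sum>i\<le>n. cscale (coeff p i) ((T ^^ i) u))"
  unfolding polyop_def using assms
  by (intro sum.mono_neutral_left) (auto simp: coeff_eq_0)

lemma polyop_0 [simp]: "polyop 0 T u = 0"
  by (simp add: polyop_def)

lemma polyop_const [simp]: "polyop [:a:] T u = cscale a u"
  by (simp add: polyop_def)

lemma polyop_add: "polyop (p + q) T u = polyop p T u + polyop q T u"
proof -
  define n where "n = max (degree p) (degree q)"
  have "degree (p + q) \<le> n" "degree p \<le> n" "degree q \<le> n"
    by (auto simp: n_def degree_add_le)
  then show ?thesis
    by (simp add: polyop_eq_sum[where n = n] cscale_algebra sum.distrib)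
qed

lemma polyop_smult: "polyop (smult c p) T u = cscale c (polyop p T u)"
  by (simp add: polyop_eq_sum[OF degree_smult_le] polyop_def[of p] cscale_sum cscale_algebra)

lemma polyop_diff: "polyop (p - q) T u = polyop p T u - polyop q T u"
proof -
  have "p - q = p + smult (- 1) q" by simp
  then show ?thesis by (simp only: polyop_add polyop_smult) (simp add: cscale_algebra)
qed

lemma polyop_pCons:
  assumes "clinear T"
  shows "polyop (pCons a p) T u = cscale a u + T (polyop p T u)"
proof -
  interpret bounded_linear T using assms by (rule clinearD)
  have "polyop (pCons a p) T u
      = (\<Sum>i\<le>Suc (degree p). cscale (coeff (pCons a p) i) ((T ^^ i) u))"
    by (intro polyop_eq_sum degree_pCons_le)
  also have "\<dots> = cscale a u + (\<Sum>i\<le>degree p. cscale (coeff p i) (T ((T ^^ i) u)))"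
    by (simp add: sum.atMost_Suc_shift del: sum.atMost_Suc)
  finally show ?thesis
    by (simp add: polyop_def sum clinearD(5)[OF assms])
qed

lemma clinear_polyop:
  assumes "clinear T" shows "clinear (polyop p T)"
proof (induction p)
  case 0
  then show ?case by (simp add: clinear_def polyop_def[abs_def])
next
  case (pCons a p)
  have "polyop (pCons a p) T = (\<lambda>u. cscale a u + T (polyop p T u))"
    using polyop_pCons[OF assms] by blast
  then show ?case using clinear_add clinear_cscale_fun clinear_compose assms pCons by metis
qed

lemma polyop_commute:
  assumes "clinear T" shows "T (polyop p T u) = polyop p T (T u)"
  by (induction p) (auto simp: polyop_pCons assms clinearD[OF assms])

lemma polyop_mult:
  assumes "clinear T" shows "polyop (p * q) T u = polyop p T (polyop q T u)"
  by (induction p) (auto simp: polyop_pCons assms clinearD[OF assms] polyop_add polyop_smult)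

lemma polyop_adjoint:
  assumes "clinear T" and sa: "\<And>u v. inner (T u) v = inner u (T v)"
  shows "inner (polyop p T u) v = inner u (polyop (map_poly cnj p) T v)"
  by (induction p arbitrary: u v)
    (auto simp: polyop_pCons assms(1) inner_add_left inner_add_right inner_cscale_left sa
      polyop_commute map_poly_pCons)

end

section \<open>Norms of polynomials of a self-adjoint operator on an invariant subspace\<close>

locale operator_on_subspace = complex_hilbert J for J :: "'h::{real_inner,banach} \<Rightarrow> 'h" +
  fixes T :: "'h \<Rightarrow> 'h" and V :: "'h set"
  assumes clinear_T: "clinear T" and self_adjoint: "\<And>u v. inner (T u) v = inner u (T v)"
    and subspace_V: "subspace V" and J_V: "\<And>u. u \<in> V \<Longrightarrow> J u \<in> V" and T_V: "\<And>u. u \<in> V \<Longrightarrow> T u \<in> V"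
begin

lemma cscale_V: "u \<in> V \<Longrightarrow> cscale z u \<in> V"
  by (simp add: cscale_def J_V subspace_V subspace_add subspace_scale)

lemma polyop_V: "u \<in> V \<Longrightarrow> polyop p T u \<in> V"
  by (induction p) (auto simp: polyop_pCons clinear_T subspace_V subspace_0 subspace_add cscale_V T_V)

text \<open>What the norm estimates retain of a resolvent: a bounded left inverse of A on
  \<open>V\<close> yields such a constant.\<close>

definition bounded_below :: "('h \<Rightarrow> 'h) \<Rightarrow> bool" where
  "bounded_below A \<longleftrightarrow> (\<exists>c\<ge>0. \<forall>u\<in>V. norm u \<le> c * norm (A u))"

text \<open>Over the complex numbers h splits into linear factors, whose roots all avoid S; each
  factor is bounded below on the invariant subspace, and the constants multiply.\<close>

lemma bounded_below_polyop:
  assumes below: "\<And>z. z \<notin> S \<Longrightarrow> bounded_below (\<lambda>u. T u - cscale z u)"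
    and "h \<noteq> 0" "\<And>z. z \<in> S \<Longrightarrow> poly h z \<noteq> 0"
  shows "bounded_below (polyop h T)"
  using assms(2,3)
proof (induction "degree h" arbitrary: h)
  case 0
  then obtain a where a: "h = [:a:]" using degree_eq_zeroE by metis
  then have "a \<noteq> 0" using 0 by simp
  then show ?case
    unfolding bounded_below_def a by (intro exI[of _ "1 / cmod a"]) (auto simp: norm_divide)
next
  case (Suc n)
  then have "\<not> constant (poly h)" by (simp add: constant_degree)
  then obtain z where z: "poly h z = 0" using fundamental_theorem_of_algebra by blast
  then obtain q where q: "h = [:- z, 1:] * q" using poly_eq_0_iff_dvd by (metis dvdE)
  then have "q \<noteq> 0" using Suc.prems by auto
  then have "degree h = Suc (degree q)" unfolding q by (subst degree_mult_eq) auto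
  then obtain c where c: "c \<ge> 0" "\<And>u. u \<in> V \<Longrightarrow> norm u \<le> c * norm (polyop q T u)"
    using Suc.hyps(1)[of q] Suc.hyps(2) Suc.prems \<open>q \<noteq> 0\<close> q by (auto simp: bounded_below_def)
  obtain d where d: "d \<ge> 0" "\<And>u. u \<in> V \<Longrightarrow> norm u \<le> d * norm (T u - cscale z u)"
    using below[of z] Suc.prems(2) z by (auto simp: bounded_below_def)
  have h: "polyop h T u = T (polyop q T u) - cscale z (polyop q T u)" for u
    by (simp add: q polyop_mult clinear_T polyop_pCons cscale_algebra polyop_add polyop_diff polyop_smult)
  have "norm u \<le> (c * d) * norm (polyop h T u)" if "u \<in> V" for u
  proof -
    have "norm u \<le> c * norm (polyop q T u)" using c that by blast
    also have "\<dots> \<le> c * (d * norm (polyop h T u))"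
      unfolding h using c d polyop_V that by (intro mult_left_mono) auto
    finally show ?thesis by (simp add: mult_ac)
  qed
  then show ?case unfolding bounded_below_def using c d by (meson mult_nonneg_nonneg)
qed

text \<open>If \<open>L\<close> is the norm of \<open>p(T)\<close> on \<open>V\<close>, then \<open>p(T)\<^sup>* p(T) - L\<^sup>2\<close> is not bounded below, so one of
  the linear factors of this polynomial in \<open>T\<close> is not bounded below either.\<close>

lemma root_of_norm:
  assumes below: "\<And>z. z \<notin> S \<Longrightarrow> bounded_below (\<lambda>u. T u - cscale z u)"
    and "degree p > 0" and L: "L > 0" "\<And>u. u \<in> V \<Longrightarrow> norm (polyop p T u) \<le> L * norm u"
    and sharp: "\<And>L'. L' < L \<Longrightarrow> \<exists>u\<in>V. norm (polyop p T u) > L' * norm u"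
  shows "\<exists>z\<in>S. poly (map_poly cnj p * p) z = complex_of_real (L\<^sup>2)"
proof (rule ccontr)
  assume no: "\<not> ?thesis"
  let ?p' = "map_poly cnj p"
  define h where "h = ?p' * p - [:complex_of_real (L\<^sup>2):]"
  have deg: "degree ?p' = degree p" using assms(2) by (intro map_poly_degree_eq) auto
  \<comment> \<open>A positive degree keeps \<open>h\<close> from being the zero polynomial, which
    has no factorisation.\<close>
  have "degree (?p' * p) = degree p + degree p"
    using assms(2) deg by (subst degree_mult_eq) (metis degree_0 less_numeral_extra(3))+
  then have "?p' * p \<noteq> [:complex_of_real (L\<^sup>2):]" using assms(2) by (metis add_is_0 degree_pCons_0 less_numeral_extra(3))
  then have "h \<noteq> 0" unfolding h_def by simp
  then have "bounded_below (polyop h T)"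
    using no by (intro bounded_below_polyop below) (auto simp: h_def)
  then obtain c where c: "c \<ge> 0" "\<And>u. u \<in> V \<Longrightarrow> norm u \<le> c * norm (polyop h T u)"
    by (auto simp: bounded_below_def)
  define c' where "c' = c + 1"
  have c': "c' > 0" "\<And>u. u \<in> V \<Longrightarrow> norm u \<le> c' * norm (polyop h T u)"
    using c by (auto simp: c'_def algebra_simps add_increasing)
  \<comment> \<open>\<open>polyop ?p' T\<close> is the adjoint of \<open>polyop p T\<close>, so it
    inherits the bound \<open>L\<close> on \<open>V\<close>.\<close>
  have adj: "norm (polyop ?p' T v) \<le> L * norm v" if "v \<in> V" for v
  proof (cases "polyop ?p' T v = 0")
    case False
    have "norm (polyop ?p' T v) * norm (polyop ?p' T v) = inner (polyop p T (polyop ?p' T v)) v"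
      unfolding polyop_adjoint[OF clinear_T self_adjoint, of p "polyop ?p' T v" v]
      by (metis power2_eq_square power2_norm_eq_inner)
    also have "\<dots> \<le> norm (polyop p T (polyop ?p' T v)) * norm v" by (rule norm_cauchy_schwarz)
    also have "\<dots> \<le> L * norm (polyop ?p' T v) * norm v"
      using L polyop_V that by (intro mult_right_mono) auto
    finally have "norm (polyop ?p' T v) * norm (polyop ?p' T v) \<le> norm (polyop ?p' T v) * (L * norm v)"
      by (simp add: mult_ac)
    then show ?thesis using False by simp
  qed (use L in simp)
  \<comment> \<open>With a = p(T) u and b = p(T)* a one has (b, u) = |a|^2 and |b| \<le> L |a|,
    hence |b - L^2 u|^2 \<le> L^2 (L^2 |u|^2 - |a|^2). The lower bound for h(T) u = b - L^2 u then
    keeps |a|^2 strictly away from L^2 |u|^2, by a fixed proportion of |u|^2.\<close>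
  have main: "(norm (polyop p T u))\<^sup>2 \<le> (L\<^sup>2 - 1 / (2 * c'\<^sup>2 * L\<^sup>2)) * (norm u)\<^sup>2" if "u \<in> V" for u
  proof -
    let ?A = "polyop p T u" let ?B = "polyop ?p' T ?A"
    have "(norm u)\<^sup>2 \<le> (c' * norm (polyop h T u))\<^sup>2" using c' that by (intro power_mono) auto
    moreover have "polyop h T u = ?B - L\<^sup>2 *\<^sub>R u"
      by (simp add: h_def polyop_diff polyop_mult clinear_T del: of_real_power)
    moreover have "(norm (?B - L\<^sup>2 *\<^sub>R u))\<^sup>2 = (norm ?B)\<^sup>2 - 2 * L\<^sup>2 * inner ?B u + (L\<^sup>2)\<^sup>2 * (norm u)\<^sup>2"
      unfolding power2_norm_eq_inner by (simp add: algebra_simps inner_commute power2_eq_square)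
    moreover have "inner ?B u = (norm ?A)\<^sup>2"
      unfolding power2_norm_eq_inner using polyop_adjoint[OF clinear_T self_adjoint, of p u ?A]
      by (simp add: inner_commute)
    moreover have "(norm ?B)\<^sup>2 \<le> (L * norm ?A)\<^sup>2" using adj polyop_V that by (intro power_mono) auto
    ultimately have "(norm u)\<^sup>2 \<le> c'\<^sup>2 * (L\<^sup>2 * (norm ?A)\<^sup>2 - 2 * L\<^sup>2 * (norm ?A)\<^sup>2 + (L\<^sup>2)\<^sup>2 * (norm u)\<^sup>2)"
      by (smt (verit) mult_left_mono power_mult_distrib zero_le_power2)
    also have "\<dots> = c'\<^sup>2 * L\<^sup>2 * (L\<^sup>2 * (norm u)\<^sup>2 - (norm ?A)\<^sup>2)"
      by (simp add: algebra_simps power2_eq_square)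
    finally have "(norm u)\<^sup>2 / (c'\<^sup>2 * L\<^sup>2) \<le> L\<^sup>2 * (norm u)\<^sup>2 - (norm ?A)\<^sup>2"
      using c' L by (simp add: divide_le_eq mult.commute)
    moreover have "(norm u)\<^sup>2 / (2 * c'\<^sup>2 * L\<^sup>2) \<le> (norm u)\<^sup>2 / (c'\<^sup>2 * L\<^sup>2)"
      using c' L by (intro divide_left_mono) auto
    ultimately show ?thesis by (simp add: algebra_simps)
  qed
  define m where "m = L\<^sup>2 - 1 / (2 * c'\<^sup>2 * L\<^sup>2)"
  have "m < L\<^sup>2" using c' L by (simp add: m_def)
  \<comment> \<open>\<open>m\<close> may be negative, hence the maximum; \<open>L'\<close> is a
    bound for p(T) on \<open>V\<close> smaller than the sharp one.\<close>
  define L' where "L' = sqrt (max m 0)"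
  have "L' < L" using \<open>m < L\<^sup>2\<close> L by (auto simp: L'_def real_less_lsqrt)
  then obtain u where u: "u \<in> V" "norm (polyop p T u) > L' * norm u" using sharp by blast
  have "(norm (polyop p T u))\<^sup>2 \<le> max m 0 * (norm u)\<^sup>2"
    using main[OF u(1)] by (smt (verit) m_def mult_right_mono zero_le_power2)
  also have "\<dots> = (L' * norm u)\<^sup>2" by (simp add: L'_def power_mult_distrib)
  finally show False using u by (smt (verit) L'_def power2_le_imp_le mult_nonneg_nonneg norm_ge_zero real_sqrt_ge_zero max.cobounded2)
qed

text \<open>Let L be the exact norm of p(T) on \<open>V\<close>. If L > B, then L > 0 and
  \<open>root_of_norm\<close> yields a point z of S where the product of p and its conjugate
  polynomial equals L^2. Since z is real, this product is |p(z)|^2, so |p(z)| = L > B.\<close>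

lemma polyop_bounded_by_spectrum_aux:
  assumes below: "\<And>z. z \<notin> S \<Longrightarrow> bounded_below (\<lambda>u. T u - cscale z u)" and real: "S \<subseteq> \<real>"
    and "degree p > 0" and B: "B \<ge> 0" "\<And>z. z \<in> S \<Longrightarrow> cmod (poly p z) \<le> B" and u: "u \<in> V"
  shows "norm (polyop p T u) \<le> B * norm u"
proof (rule ccontr)
  assume neg: "\<not> ?thesis"
  let ?f = "\<lambda>u. norm (polyop p T u) / norm u"
  interpret P: bounded_linear "polyop p T" using clinear_polyop[OF clinear_T] by (rule clinearD)
  obtain K where K: "K > 0" "\<And>u. norm (polyop p T u) \<le> norm u * K" using P.pos_bounded by blast
  define L where "L = Sup (?f ` V)"
  have bdd: "bdd_above (?f ` V)"
    using K by (intro bdd_aboveI2[of _ _ K]) (auto simp: divide_le_eq mult.commute)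
  have le: "norm (polyop p T u) \<le> L * norm u" if "u \<in> V" for u
  proof (cases "u = 0")
    case False
    have "?f u \<le> L" unfolding L_def using bdd that by (intro cSup_upper) auto
    then show ?thesis using False by (simp add: divide_le_eq)
  qed (simp add: P.zero)
  have "u \<noteq> 0" using neg by (auto simp: P.zero)
  have "B * norm u < L * norm u" using le[OF u] neg by simp
  then have "B < L" by (simp add: mult_less_cancel_right)
  have "\<exists>u\<in>V. norm (polyop p T u) > L' * norm u" if "L' < L" for L'
  proof -
    \<comment> \<open>Exceeding \<open>B\<close> as well excludes the zero vector, at which the
      quotient has the default value 0.\<close>
    have "\<exists>x\<in>?f ` V. max L' B < x" using that u bdd \<open>B < L\<close> unfolding L_def
      by (intro less_cSupD) auto
    then obtain v where v: "v \<in> V" "max L' B < ?f v" by blast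
    then have "v \<noteq> 0" using B(1) by auto
    then show ?thesis using v by (intro bexI[of _ v])
      (auto simp: less_divide_eq elim!: le_less_trans[rotated] intro!: mult_right_mono)
  qed
  then obtain z where z: "z \<in> S" "poly (map_poly cnj p * p) z = complex_of_real (L\<^sup>2)"
    using root_of_norm[OF below assms(3) _ le] B(1) \<open>B < L\<close> by force
  have "cnj z = z" using z real by (auto simp: Reals_cnj_iff)
  then have "poly (map_poly cnj p) z = cnj (poly p z)"
    by (metis complex_cnj_cnj poly_cnj)
  then have "complex_of_real ((cmod (poly p z))\<^sup>2) = complex_of_real (L\<^sup>2)"
    using z(2) complex_norm_square[of "poly p z"] by (simp add: mult.commute)
  then have "(cmod (poly p z))\<^sup>2 = L\<^sup>2" by (simp only: of_real_eq_iff)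
  then have "cmod (poly p z) = L" using \<open>B < L\<close> B(1) by (simp add: power2_eq_iff_nonneg)
  then show False using B(2)[OF z(1)] \<open>B < L\<close> by simp
qed

text \<open>Covers constant polynomials too. If S has a point, they are immediate. If S is empty,
  \<open>V\<close> must be shown to be trivial: the polynomial X satisfies the bound 0, so
  \<open>T\<close> vanishes on \<open>V\<close>, yet \<open>T\<close> is bounded below
  there.\<close>

lemma polyop_bounded_by_spectrum:
  assumes below: "\<And>z. z \<notin> S \<Longrightarrow> bounded_below (\<lambda>u. T u - cscale z u)" and real: "S \<subseteq> \<real>"
    and B: "B \<ge> 0" "\<And>z. z \<in> S \<Longrightarrow> cmod (poly p z) \<le> B" and u: "u \<in> V"
  shows "norm (polyop p T u) \<le> B * norm u"
proof (cases "degree p = 0")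
  case True
  then obtain a where a: "p = [:a:]" using degree_eq_zeroE by metis
  show ?thesis
  proof (cases "S = {}")
    case True
    have "norm (polyop [:0, 1:] T u) \<le> 0 * norm u"
      using True u by (intro polyop_bounded_by_spectrum_aux[OF below real]) auto
    then have "T u = 0" by (simp add: polyop_pCons clinear_T clinearD(6)[OF clinear_T])
    moreover have "bounded_below (\<lambda>u. T u - cscale 0 u)" using below True by blast
    ultimately have "u = 0" using u by (auto simp: bounded_below_def)
    then show ?thesis by (simp add: a)
  next
    case False
    then show ?thesis using B by (auto simp: a intro!: mult_right_mono)
  qed
next
  case False
  then show ?thesis using B u by (intro polyop_bounded_by_spectrum_aux[OF below real]) auto
qed

end

section \<open>Resolvents and functional calculus of a positive operator\<close>

locale positive_operator = operator_on_subspace J T UNIV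
  for J :: "'h::{real_inner,banach} \<Rightarrow> 'h" and T +
  fixes M :: real
  assumes positive: "\<And>u. inner (T u) u \<ge> 0" and M_pos: "M > 0"
    and T_bound: "\<And>u. norm (T u) \<le> M * norm u"
begin

text \<open>The operator form of t^2 \<le> M t for 0 \<le> t \<le> M. It combines t (1 - t/M)^2
  \<ge> 0, which is positivity at \<open>?w\<close>, with t^3 \<le> M t^2, which is the norm bound
  at \<open>T u\<close>.\<close>

lemma norm_T_square_le: "(norm (T u))\<^sup>2 \<le> M * inner (T u) u"
proof -
  let ?w = "u - (1 / M) *\<^sub>R T u"
  have "0 \<le> inner (T ?w) ?w" by (rule positive)
  also have "\<dots> = inner (T u) u - 2 / M * (norm (T u))\<^sup>2 + (1 / M)\<^sup>2 * inner (T (T u)) (T u)"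
    unfolding power2_norm_eq_inner
    by (simp add: clinearD[OF clinear_T] algebra_simps self_adjoint[of u "T u", symmetric] power2_eq_square inner_commute)
  also have "inner (T (T u)) (T u) \<le> M * norm (T u) * norm (T u)"
    using norm_cauchy_schwarz[of "T (T u)" "T u"] T_bound[of "T u"]
    by (smt (verit) mult_right_mono norm_ge_zero)
  finally have "0 \<le> inner (T u) u - 2 / M * (norm (T u))\<^sup>2 + (1 / M)\<^sup>2 * (M * norm (T u) * norm (T u))"
    by (simp add: mult_left_mono)
  also have "\<dots> = inner (T u) u - (norm (T u))\<^sup>2 / M"
    using M_pos by (simp add: field_simps power2_eq_square)
  finally show ?thesis using M_pos by (simp add: field_simps)
qed

text \<open>Every point off the segment \<open>[0, M]\<close> lies outside some circle through \<open>0\<close> and \<open>M\<close>, and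
  \<open>T\<close> differs from its centre by an operator of norm at most the radius, which makes the
  resolvent equation a contraction problem.\<close>

lemma norm_shifted_le:
  "norm (T u - cscale (Complex (M / 2) b) u) \<le> sqrt ((M / 2)\<^sup>2 + b\<^sup>2) * norm u"
proof -
  have "inner (T u) (J u) = 0"
    using self_adjoint[of u "J u"] inner_J_left[of u "T u"]
    by (simp add: clinearD[OF clinear_T] inner_commute)
  then have "(norm (T u - cscale (Complex (M / 2) b) u))\<^sup>2
      = (norm (T u))\<^sup>2 - M * inner (T u) u + ((M / 2)\<^sup>2 + b\<^sup>2) * (norm u)\<^sup>2"
    unfolding power2_norm_eq_inner
    by (simp add: cscale_def algebra_simps power2_eq_square inner_commute)
  also have "\<dots> \<le> (sqrt ((M / 2)\<^sup>2 + b\<^sup>2) * norm u)\<^sup>2"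
    using norm_T_square_le[of u] by (simp add: power_mult_distrib)
  finally show ?thesis by (rule power2_le_imp_le) simp
qed

lemma separating_circle:
  assumes "z \<notin> complex_of_real ` {0..M}"
  obtains b where "sqrt ((M / 2)\<^sup>2 + b\<^sup>2) < cmod (z - Complex (M / 2) b)"
proof -
  define x y where "x = Re z" and "y = Im z"
  \<comment> \<open>\<open>d\<close> is the power of z with respect to the circle with diameter
    [0, M]; moving the centre by \<open>b\<close> in the imaginary direction changes it to d - 2 y
    b, and z is outside when this is positive.\<close>
  define d where "d = (x - M / 2)\<^sup>2 + y\<^sup>2 - (M / 2)\<^sup>2"
  note result = that
  have crit: thesis if "2 * y * b < d" for b
  proof (rule result)
    have "(cmod (z - Complex (M / 2) b))\<^sup>2 = d + (M / 2)\<^sup>2 - 2 * y * b + b\<^sup>2"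
      unfolding cmod_power2 by (simp add: x_def y_def d_def power2_eq_square algebra_simps)
    then have "(M / 2)\<^sup>2 + b\<^sup>2 < (cmod (z - Complex (M / 2) b))\<^sup>2" using \<open>2 * y * b < d\<close> by simp
    then show "sqrt ((M / 2)\<^sup>2 + b\<^sup>2) < cmod (z - Complex (M / 2) b)" by (simp add: real_less_lsqrt)
  qed
  show thesis
  proof (cases "y = 0")
    case False
    then show thesis by (intro crit[of "(d - 1) / (2 * y)"]) auto
  next
    case True
    then have "z = complex_of_real x" by (simp add: x_def y_def complex_eq_iff)
    then have "x < 0 \<or> M < x" using assms by (auto simp: image_iff not_le)
    then have "0 < x * (x - M)" using M_pos by (auto intro: mult_pos_pos mult_neg_neg)
    then show thesis using True by (intro crit[of 0]) (simp add: d_def power2_eq_square algebra_simps)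
  qed
qed

lemma resolvent_exists:
  assumes "z \<notin> complex_of_real ` {0..M}"
  obtains R C where "clinear R" "\<And>u. R (T u - cscale z u) = u" "\<And>u. T (R u) - cscale z (R u) = u"
    "C \<ge> 0" "\<And>u. norm u \<le> C * norm (T u - cscale z u)"
proof -
  obtain b where b: "sqrt ((M / 2)\<^sup>2 + b\<^sup>2) < cmod (z - Complex (M / 2) b)"
    using separating_circle[OF assms] .
  define c where "c = Complex (M / 2) b"
  define r where "r = sqrt ((M / 2)\<^sup>2 + b\<^sup>2)"
  have r: "0 \<le> r" "r < cmod (z - c)" using b by (auto simp: r_def c_def)
  then have "z \<noteq> c" by auto
  have bound: "norm (T u - cscale c u) \<le> r * norm u" for u
    unfolding c_def r_def by (rule norm_shifted_le)
  define A where "A u = T u - cscale z u" for u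
  have A: "clinear A" unfolding A_def by (intro clinear_diff clinear_T clinear_cscale_fun)
  have eq: "A u = (T u - cscale c u) - cscale (z - c) u" for u
    by (simp add: A_def cscale_algebra)
  define C where "C = 1 / (cmod (z - c) - r)"
  have below: "norm u \<le> C * norm (A u)" for u
  proof -
    have "cmod (z - c) * norm u \<le> norm (T u - cscale c u) + norm (A u)"
      using norm_triangle_ineq4[of "T u - cscale c u" "A u"] by (simp add: eq)
    then have "(cmod (z - c) - r) * norm u \<le> norm (A u)"
      using bound[of u] by (simp add: algebra_simps)
    then show ?thesis using r by (simp add: C_def field_simps)
  qed
  have inj: "u = v" if "A u = A v" for u v
    using below[of "u - v"] that by (simp add: clinearD(2)[OF A])
  have surj: "\<exists>u. A u = v" for v
  proof -
    \<comment> \<open>Fixed points of \<open>F\<close> solve \<open>A u = v\<close>, rewritten as (z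
      - c) u = (T u - c u) - v; the contraction ratio is r / |z - c| < 1.\<close>
    define F where "F u = cscale (inverse (z - c)) ((T u - cscale c u) - v)" for u
    have diff: "F u - F w = cscale (inverse (z - c)) (T (u - w) - cscale c (u - w))" for u w
      by (simp add: F_def cscale_algebra clinearD[OF clinear_T])
    have "dist (F u) (F w) \<le> r / cmod (z - c) * dist u w" for u w
      using bound[of "u - w"] r unfolding dist_norm diff norm_cscale norm_inverse
      by (simp add: field_simps)
        (metis divide_right_mono norm_ge_zero)
    then have "\<exists>!u. F u = u"
      using r by (intro banach_fix_type[where c = "r / cmod (z - c)"]) (auto simp: divide_less_eq)
    then obtain u where "F u = u" by blast
    then have "cscale (z - c) u = cscale (z - c) (F u)" by simp
    also have "\<dots> = (T u - cscale c u) - v"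
      using \<open>z \<noteq> c\<close> by (simp add: F_def cscale_algebra(5))
    finally have "A u = v" by (simp add: eq)
    then show ?thesis ..
  qed
  define R where "R v = (SOME u. A u = v)" for v
  have AR: "A (R v) = v" for v unfolding R_def using surj by (rule someI_ex)
  have RA: "R (A u) = u" for u using AR inj by blast
  have "clinear R"
    unfolding clinear_def
  proof (intro conjI allI bounded_linear_intro[where K = C])
    show "norm (R v) \<le> norm v * C" for v
      using below[of "R v"] by (simp add: AR mult.commute)
  qed (rule inj, simp add: AR clinearD[OF A])+
  then show thesis using AR RA below r by (intro that[of R C]) (auto simp: A_def C_def)
qed

lemma bounded_below_resolvent:
  "z \<notin> complex_of_real ` {0..M} \<Longrightarrow> bounded_below (\<lambda>u. T u - cscale z u)"
  using resolvent_exists unfolding bounded_below_def by metis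

lemma polyop_norm_le:
  assumes "B \<ge> 0" "\<And>t. t \<in> {0..M} \<Longrightarrow> cmod (poly p (complex_of_real t)) \<le> B"
  shows "norm (polyop p T u) \<le> B * norm u"
  using assms by (intro polyop_bounded_by_spectrum[OF bounded_below_resolvent]) auto

text \<open>By \<open>polyop_norm_le\<close>, uniform convergence on [0, M] makes the polynomials of
  T a Cauchy sequence in the complete space of bounded linear maps. Compatibility with
  \<open>J\<close> survives the limit, so the limit is complex linear.\<close>

lemma functional_calculus:
  fixes q :: "nat \<Rightarrow> complex poly"
  assumes "uniformly_convergent_on {0..M} (\<lambda>n t. poly (q n) (complex_of_real t))"
  obtains G e where "clinear G" "e \<longlonglongrightarrow> 0" "\<And>n u. norm (polyop (q n) T u - G u) \<le> e n * norm u"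
proof -
  define X where "X n = Blinfun (polyop (q n) T)" for n
  have X: "blinfun_apply (X n) = polyop (q n) T" for n
    unfolding X_def using clinear_polyop[OF clinear_T] by (intro bounded_linear_Blinfun_apply clinearD)
  have "Cauchy X"
  proof (rule metric_CauchyI)
    fix e :: real assume "0 < e"
    have "uniformly_Cauchy_on {0..M} (\<lambda>n t. poly (q n) (complex_of_real t))"
      using assms by (rule uniformly_convergent_Cauchy)
    then obtain N where N: "\<And>t m n. t \<in> {0..M} \<Longrightarrow> m \<ge> N \<Longrightarrow> n \<ge> N \<Longrightarrow>
        dist (poly (q m) (complex_of_real t)) (poly (q n) (complex_of_real t)) < e / 2"
      using \<open>0 < e\<close> unfolding uniformly_Cauchy_on_def by (meson half_gt_zero)
    have "dist (X m) (X n) < e" if "m \<ge> N" "n \<ge> N" for m n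
    proof -
      have "norm (polyop (q m - q n) T u) \<le> e / 2 * norm u" for u
        using N that \<open>0 < e\<close> by (intro polyop_norm_le) (auto simp: dist_norm less_imp_le)
      then have "norm (X m - X n) \<le> e / 2"
        using \<open>0 < e\<close> by (intro norm_blinfun_bound) (auto simp: X blinfun.diff_left polyop_diff)
      then show ?thesis using \<open>0 < e\<close> by (simp add: dist_norm)
    qed
    then show "\<exists>N. \<forall>m\<ge>N. \<forall>n\<ge>N. dist (X m) (X n) < e" by blast
  qed
  then obtain G where G: "X \<longlonglongrightarrow> G" using Cauchy_convergent convergent_def by blast
  have lim: "(\<lambda>n. X n u) \<longlonglongrightarrow> G u" for u by (intro tendsto_intros G)
  interpret J: bounded_linear J by (intro bounded_linear_intro[where K = 1]) auto
  have "G (J u) = J (G u)" for u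
  proof (rule LIMSEQ_unique[OF lim])
    have "X n (J u) = J (X n u)" for n
      unfolding X using clinear_polyop[OF clinear_T] by (rule clinearD)
    then show "(\<lambda>n. X n (J u)) \<longlonglongrightarrow> J (G u)" by (simp add: J.tendsto lim)
  qed
  then have "clinear (blinfun_apply G)" by (simp add: clinear_def blinfun.bounded_linear_right)
  moreover have "(\<lambda>n. norm (X n - G)) \<longlonglongrightarrow> 0" using G by (simp add: LIM_zero tendsto_norm_zero)
  moreover have "norm (polyop (q n) T u - G u) \<le> norm (X n - G) * norm u" for n u
    using norm_blinfun[of "X n - G" u] by (simp add: X blinfun.diff_left)
  ultimately show thesis by (rule that)
qed

end

section \<open>The Hilbert space of square-integrable functions\<close>

definition square_integrable :: "('a::euclidean_space \<Rightarrow> complex) \<Rightarrow> bool" where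
  "square_integrable f \<longleftrightarrow>
     f \<in> borel_measurable lebesgue \<and> integrable lebesgue (\<lambda>x. (cmod (f x))\<^sup>2)"

lemma square_integrable_measurable [measurable_dest]:
  "square_integrable f \<Longrightarrow> f \<in> borel_measurable lebesgue"
  by (simp add: square_integrable_def)

lemma square_integrableD:
  "square_integrable f \<Longrightarrow> integrable lebesgue (\<lambda>x. (cmod (f x))\<^sup>2)"
  by (simp add: square_integrable_def)

lemma square_integrable_bound:
  assumes [measurable]: "f \<in> borel_measurable lebesgue" "integrable lebesgue g"
    and "AE x in lebesgue. (cmod (f x))\<^sup>2 \<le> g x"
  shows "square_integrable f"
  unfolding square_integrable_def using assms
  by (auto intro!: Bochner_Integration.integrable_bound[OF assms(2)])

lemma square_integrable_add:
  assumes "square_integrable f" "square_integrable g"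
  shows "square_integrable (\<lambda>x. f x + g x)"
proof (rule square_integrable_bound)
  note assms[measurable]
  show "(\<lambda>x. f x + g x) \<in> borel_measurable lebesgue" by measurable
  show "integrable lebesgue (\<lambda>x. 2 * (cmod (f x))\<^sup>2 + 2 * (cmod (g x))\<^sup>2)"
    by (intro Bochner_Integration.integrable_add integrable_mult_right square_integrableD assms)
  have "(cmod (a + b))\<^sup>2 \<le> 2 * (cmod a)\<^sup>2 + 2 * (cmod b)\<^sup>2" for a b
  proof -
    have "(cmod (a + b))\<^sup>2 \<le> (cmod a + cmod b)\<^sup>2" by (intro power_mono norm_triangle_ineq) auto
    moreover have "0 \<le> (cmod a - cmod b)\<^sup>2" by simp
    ultimately show ?thesis unfolding power2_sum power2_diff by linarith
  qed
  then show "AE x in lebesgue. (cmod (f x + g x))\<^sup>2 \<le> 2 * (cmod (f x))\<^sup>2 + 2 * (cmod (g x))\<^sup>2"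
    by simp
qed

lemma square_integrable_mult:
  "square_integrable f \<Longrightarrow> square_integrable (\<lambda>x. c * f x)"
  unfolding square_integrable_def by (auto simp: norm_mult power_mult_distrib)

lemma square_integrable_uminus:
  "square_integrable f \<Longrightarrow> square_integrable (\<lambda>x. - f x)"
  using square_integrable_mult[of f "- 1"] by simp

lemma square_integrable_diff:
  "square_integrable f \<Longrightarrow> square_integrable g \<Longrightarrow> square_integrable (\<lambda>x. f x - g x)"
  using square_integrable_add[OF _ square_integrable_uminus] by fastforce

lemma square_integrable_zero: "square_integrable (\<lambda>x. 0)"
  by (simp add: square_integrable_def)

lemma borel_measurable_cnj [measurable (raw)]:
  "f \<in> borel_measurable M \<Longrightarrow> (\<lambda>x. cnj (f x)) \<in> borel_measurable M"
  by (rule measurable_compose[OF _ borel_measurable_continuous_onI]) (auto intro!: continuous_intros)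

lemma integrable_mult_cnj:
  assumes "square_integrable f" "square_integrable g"
  shows "integrable lebesgue (\<lambda>x. f x * cnj (g x))"
proof (rule Bochner_Integration.integrable_bound)
  note assms[measurable]
  show "integrable lebesgue (\<lambda>x. (cmod (f x))\<^sup>2 + (cmod (g x))\<^sup>2)"
    using assms by (auto dest: square_integrableD)
  show "(\<lambda>x. f x * cnj (g x)) \<in> borel_measurable lebesgue" by measurable
  have "cmod a * cmod b \<le> (cmod a)\<^sup>2 + (cmod b)\<^sup>2" for a b
    using zero_le_power2[of "cmod a - cmod b"] zero_le_power2[of "cmod a"] zero_le_power2[of "cmod b"]
    unfolding power2_diff by linarith
  then show "AE x in lebesgue. norm (f x * cnj (g x)) \<le> norm ((cmod (f x))\<^sup>2 + (cmod (g x))\<^sup>2)"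
    by (simp add: norm_mult)
qed

lemma inner_complex_mult_cnj: "inner a b = Re (a * cnj b)"
  by (simp add: inner_complex_def)

lemma integrable_inner:
  assumes "square_integrable f" "square_integrable g"
  shows "integrable lebesgue (\<lambda>x. inner (f x) (g x))"
  using integrable_mult_cnj[OF assms] unfolding inner_complex_mult_cnj by (rule integrable_Re)

text \<open>Square integrability is part of the relation, so it is reflexive exactly on the
  square-integrable functions and the partial quotient contains nothing else.\<close>

definition l2_rel :: "('a::euclidean_space \<Rightarrow> complex) \<Rightarrow> ('a \<Rightarrow> complex) \<Rightarrow> bool" where
  "l2_rel f g \<longleftrightarrow> square_integrable f \<and> square_integrable g \<and> (AE x in lebesgue. f x = g x)"

quotient_type (overloaded) 'a l2 = "'a::euclidean_space \<Rightarrow> complex" / partial: l2_rel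
  morphisms rep_l2 abs_l2
proof (rule part_equivpI)
  show "\<exists>x. l2_rel x x" using square_integrable_zero by (auto simp: l2_rel_def)
  show "symp l2_rel" by (auto simp: l2_rel_def symp_def)
  show "transp l2_rel" unfolding l2_rel_def transp_def by auto
qed

instantiation l2 :: (euclidean_space) real_inner
begin

lift_definition zero_l2 :: "'a l2" is "\<lambda>x. 0"
  by (simp add: l2_rel_def square_integrable_zero)

lift_definition plus_l2 :: "'a l2 \<Rightarrow> 'a l2 \<Rightarrow> 'a l2" is "\<lambda>f g x. f x + g x"
  unfolding l2_rel_def by (auto intro: square_integrable_add)

lift_definition uminus_l2 :: "'a l2 \<Rightarrow> 'a l2" is "\<lambda>f x. - f x"
  unfolding l2_rel_def by (auto intro: square_integrable_uminus)

lift_definition minus_l2 :: "'a l2 \<Rightarrow> 'a l2 \<Rightarrow> 'a l2" is "\<lambda>f g x. f x - g x"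
  unfolding l2_rel_def by (auto intro: square_integrable_diff)

lift_definition scaleR_l2 :: "real \<Rightarrow> 'a l2 \<Rightarrow> 'a l2" is "\<lambda>r f x. complex_of_real r * f x"
  unfolding l2_rel_def by (auto intro: square_integrable_mult)

lift_definition inner_l2 :: "'a l2 \<Rightarrow> 'a l2 \<Rightarrow> real" is "\<lambda>f g. LINT x|lebesgue. inner (f x) (g x)"
proof -
  fix f f' g g' :: "'a \<Rightarrow> complex"
  assume "l2_rel f f'" "l2_rel g g'"
  then have [measurable]: "f \<in> borel_measurable lebesgue" "g \<in> borel_measurable lebesgue"
    "f' \<in> borel_measurable lebesgue" "g' \<in> borel_measurable lebesgue"
    and "AE x in lebesgue. f x = f' x" "AE x in lebesgue. g x = g' x"
    by (auto simp: l2_rel_def square_integrable_def)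
  then show "(LINT x|lebesgue. inner (f x) (g x)) = (LINT x|lebesgue. inner (f' x) (g' x))"
    by (intro integral_cong_AE) auto
qed

definition norm_l2 :: "'a l2 \<Rightarrow> real" where "norm_l2 u = sqrt (inner u u)"
definition dist_l2 :: "'a l2 \<Rightarrow> 'a l2 \<Rightarrow> real" where "dist_l2 u v = norm (u - v)"
definition sgn_l2 :: "'a l2 \<Rightarrow> 'a l2" where "sgn_l2 u = inverse (norm u) *\<^sub>R u"
definition uniformity_l2 :: "('a l2 \<times> 'a l2) filter" where
  "uniformity_l2 = (INF e\<in>{0<..}. principal {(x, y). dist x y < e})"
definition open_l2 :: "'a l2 set \<Rightarrow> bool" where
  "open_l2 U \<longleftrightarrow> (\<forall>x\<in>U. eventually (\<lambda>(x', y). x' = x \<longrightarrow> y \<in> U) uniformity)"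

instance
proof
  fix u v w :: "'a l2" and r s :: real
  show "u + v + w = u + (v + w)"
    by transfer (simp add: l2_rel_def square_integrable_add add.assoc)
  show "u + v = v + u"
    by transfer (simp add: l2_rel_def square_integrable_add add.commute)
  show "0 + u = u"
    by transfer (simp add: l2_rel_def)
  show "- u + u = 0"
    by transfer (simp add: l2_rel_def square_integrable_zero)
  show "u - v = u + - v"
    by transfer (simp add: l2_rel_def square_integrable_diff)
  show "r *\<^sub>R (u + v) = r *\<^sub>R u + r *\<^sub>R v"
    by transfer (simp add: l2_rel_def square_integrable_add square_integrable_mult distrib_left)
  show "(r + s) *\<^sub>R u = r *\<^sub>R u + s *\<^sub>R u"
    by transfer (simp add: l2_rel_def square_integrable_add square_integrable_mult distrib_right)
  show "r *\<^sub>R s *\<^sub>R u = (r * s) *\<^sub>R u"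
    by transfer (simp add: l2_rel_def square_integrable_mult mult.assoc)
  show "1 *\<^sub>R u = u"
    by transfer (simp add: l2_rel_def)
  show "inner u v = inner v u"
    by transfer (simp add: inner_commute)
  show "inner (u + v) w = inner u w + inner v w"
    by transfer (simp add: l2_rel_def inner_add_left integrable_inner)
  show "inner (r *\<^sub>R u) v = r * inner u v"
    by transfer (simp add: scaleR_conv_of_real[symmetric])
  show "0 \<le> inner u u"
    by transfer simp
  show "(inner u u = 0) = (u = 0)"
  proof (transfer, goal_cases)
    case (1 f)
    then have "square_integrable f" by (simp add: l2_rel_def)
    then show ?case
      using integral_nonneg_eq_0_iff_AE[OF integrable_inner[of f f]]
      by (auto simp: l2_rel_def square_integrable_zero)
  qed
qed (simp_all add: norm_l2_def dist_l2_def sgn_l2_def uniformity_l2_def open_l2_def)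

end

lemma square_integrable_rep: "square_integrable (rep_l2 u)"
  using Quotient_rep_reflp[OF Quotient_l2] by (auto simp: l2_rel_def)

lemma abs_rep_l2 [simp]: "abs_l2 (rep_l2 u) = u"
  using Quotient_abs_rep[OF Quotient_l2] .

lemma abs_l2_eq_iff:
  "square_integrable f \<Longrightarrow> square_integrable g \<Longrightarrow> abs_l2 f = abs_l2 g \<longleftrightarrow> (AE x in lebesgue. f x = g x)"
  using Quotient_rel[OF Quotient_l2, of f g] by (auto simp: l2_rel_def)

lemma rep_abs_l2:
  "square_integrable f \<Longrightarrow> AE x in lebesgue. rep_l2 (abs_l2 f) x = f x"
  using abs_l2_eq_iff[OF square_integrable_rep, of f "abs_l2 f"] by simp

lemma l2_rel_self: "square_integrable f \<Longrightarrow> l2_rel f f"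
  by (simp add: l2_rel_def)

lemma abs_l2_add:
  "square_integrable f \<Longrightarrow> square_integrable g \<Longrightarrow> abs_l2 f + abs_l2 g = abs_l2 (\<lambda>x. f x + g x)"
  by (intro plus_l2.abs_eq l2_rel_self)

lemma abs_l2_diff:
  "square_integrable f \<Longrightarrow> square_integrable g \<Longrightarrow> abs_l2 f - abs_l2 g = abs_l2 (\<lambda>x. f x - g x)"
  by (intro minus_l2.abs_eq l2_rel_self)

lemma abs_l2_scaleR:
  "square_integrable f \<Longrightarrow> r *\<^sub>R abs_l2 f = abs_l2 (\<lambda>x. complex_of_real r * f x)"
  by (intro scaleR_l2.abs_eq l2_rel_self)

lemma inner_abs_l2:
  "square_integrable f \<Longrightarrow> square_integrable g \<Longrightarrow>
     inner (abs_l2 f) (abs_l2 g) = (LINT x|lebesgue. inner (f x) (g x))"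
  by (intro inner_l2.abs_eq l2_rel_self)

lemma norm_abs_l2:
  "square_integrable f \<Longrightarrow> norm (abs_l2 f) = sqrt (LINT x|lebesgue. (cmod (f x))\<^sup>2)"
  by (simp add: norm_eq_sqrt_inner inner_abs_l2 power2_norm_eq_inner)

lemma nn_integral_norm_abs_l2:
  assumes "square_integrable f"
  shows "(\<integral>\<^sup>+x. ennreal ((cmod (f x))\<^sup>2) \<partial>lebesgue) = ennreal ((norm (abs_l2 f))\<^sup>2)"
  using assms by (simp add: norm_abs_l2 nn_integral_eq_integral[OF square_integrableD])

text \<open>The Riesz-Fischer theorem: a fast subsequence converges almost everywhere, and Fatou's
  lemma turns its pointwise limit into the norm limit of the whole sequence.\<close>

instance l2 :: (euclidean_space) banach
proof
  fix X :: "nat \<Rightarrow> 'a l2"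
  assume "Cauchy X"
  then have "\<forall>k. \<exists>N. \<forall>m\<ge>N. \<forall>n\<ge>N. dist (X m) (X n) < (1 / 2) ^ k"
    by (intro allI metric_CauchyD) auto
  then obtain N where N: "\<And>k m n. m \<ge> N k \<Longrightarrow> n \<ge> N k \<Longrightarrow> dist (X m) (X n) < (1 / 2) ^ k"
    by metis
  \<comment> \<open>The sum is an index beyond all of \<open>N 0\<close>, ..., \<open>N k\<close> at
    once.\<close>
  define r where "r k = (\<Sum>i\<le>k. N i)" for k
  have r: "r k \<ge> N j" if "j \<le> k" for j k
    unfolding r_def using that by (intro member_le_sum) auto
  define F where "F n = rep_l2 (X n)" for n
  have F: "square_integrable (F n)" for n by (simp add: F_def square_integrable_rep)
  note [measurable] = square_integrable_measurable[OF F]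
  define d where "d k x = F (r (Suc k)) x - F (r k) x" for k x
  have d: "square_integrable (d k)" for k unfolding d_def by (intro square_integrable_diff F)
  note [measurable] = square_integrable_measurable[OF d]
  have norm_F: "(\<integral>\<^sup>+x. ennreal ((cmod (F m x - F n x))\<^sup>2) \<partial>lebesgue) = ennreal ((dist (X m) (X n))\<^sup>2)" for m n
    using nn_integral_norm_abs_l2[OF square_integrable_diff[OF F F], of m n]
    by (simp add: abs_l2_diff[OF F F, symmetric] dist_norm) (simp add: F_def)
  \<comment> \<open>The squared norm of \<open>d k\<close> is at most 4^-k. The weight 2^k leaves
    summable integrals and still forces |d k x| \<le> 2^(-k/2) eventually, for almost every
    x.\<close>
  have d_le: "(\<integral>\<^sup>+x. ennreal (2 ^ k * (cmod (d k x))\<^sup>2) \<partial>lebesgue) \<le> ennreal ((1 / 2) ^ k)" for k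
  proof -
    have "(\<integral>\<^sup>+x. ennreal (2 ^ k * (cmod (d k x))\<^sup>2) \<partial>lebesgue)
        = ennreal (2 ^ k) * ennreal ((dist (X (r (Suc k))) (X (r k)))\<^sup>2)"
      unfolding norm_F[symmetric] d_def[symmetric] by (simp add: ennreal_mult nn_integral_cmult)
    also have "\<dots> \<le> ennreal (2 ^ k) * ennreal (((1 / 2) ^ k)\<^sup>2)"
      using N[of k "r (Suc k)" "r k"] r[of k "Suc k"] r[of k k]
      by (intro mult_left_mono ennreal_leI power_mono) auto
    also have "\<dots> = ennreal ((1 / 2) ^ k)"
      by (simp add: ennreal_mult[symmetric] power_mult_distrib power2_eq_square power_one_over)
    finally show ?thesis .
  qed
  have "(\<integral>\<^sup>+x. (\<Sum>k. ennreal (2 ^ k * (cmod (d k x))\<^sup>2)) \<partial>lebesgue) \<le> (\<Sum>k. ennreal ((1 / 2) ^ k))"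
    by (subst nn_integral_suminf) (measurable, rule suminf_le[OF d_le], simp_all)
  also have "\<dots> < \<infinity>"
    by (subst suminf_ennreal2[OF _ summable_geometric]) simp_all
  finally have "AE x in lebesgue. (\<Sum>k. ennreal (2 ^ k * (cmod (d k x))\<^sup>2)) \<noteq> \<infinity>"
    by (intro nn_integral_noteq_infinite) auto
  then have conv: "AE x in lebesgue. convergent (\<lambda>k. F (r k) x)"
  proof eventually_elim
    case (elim x)
    then have "summable (\<lambda>k. 2 ^ k * (cmod (d k x))\<^sup>2)"
      by (intro summable_suminf_not_top) auto
    then have "(\<lambda>k. 2 ^ k * (cmod (d k x))\<^sup>2) \<longlonglongrightarrow> 0" by (rule summable_LIMSEQ_zero)
    then have "\<forall>\<^sub>F k in sequentially. 2 ^ k * (cmod (d k x))\<^sup>2 < 1"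
      by (rule order_tendstoD) simp
    then have "\<forall>\<^sub>F k in sequentially. norm (d k x) \<le> (1 / sqrt 2) ^ k"
    proof eventually_elim
      case (elim k)
      have "((1 / sqrt 2) ^ k)\<^sup>2 = (1 / 2) ^ k"
        by (simp add: power_commutes[symmetric] power2_eq_square power_mult_distrib[symmetric])
      then have "(cmod (d k x))\<^sup>2 \<le> ((1 / sqrt 2) ^ k)\<^sup>2"
        using elim by (simp add: power_one_over pos_le_divide_eq mult.commute)
      then show ?case by (rule power2_le_imp_le) simp
    qed
    then have "summable (\<lambda>k. d k x)"
      by (rule summable_comparison_test_ev) (rule summable_geometric, simp)
    then have "convergent (\<lambda>n. F (r 0) x + (\<Sum>k<n. d k x))"
      by (intro convergent_add convergent_const) (simp add: summable_iff_convergent)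
    moreover have "F (r 0) x + (\<Sum>k<n. d k x) = F (r n) x" for n
      unfolding d_def by (subst sum_lessThan_telescope) simp
    ultimately show ?case by simp
  qed
  define f where "f x = lim (\<lambda>k. F (r k) x)" for x
  have [measurable]: "f \<in> borel_measurable lebesgue"
    unfolding f_def by (intro borel_measurable_lim_metric) measurable
  have lim: "AE x in lebesgue. (\<lambda>k. F (r k) x) \<longlonglongrightarrow> f x"
    using conv unfolding f_def by (simp add: convergent_LIMSEQ_iff)
  have close: "(\<integral>\<^sup>+x. ennreal ((cmod (F n x - f x))\<^sup>2) \<partial>lebesgue) \<le> ennreal (((1 / 2) ^ j)\<^sup>2)"
    if "n \<ge> N j" for n j
  proof -
    have "(\<integral>\<^sup>+x. ennreal ((cmod (F n x - f x))\<^sup>2) \<partial>lebesgue)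
        = (\<integral>\<^sup>+x. liminf (\<lambda>k. ennreal ((cmod (F n x - F (r k) x))\<^sup>2)) \<partial>lebesgue)"
    proof (rule nn_integral_cong_AE, use lim in eventually_elim)
      case (elim x)
      have "(\<lambda>k. ennreal ((cmod (F n x - F (r k) x))\<^sup>2)) \<longlonglongrightarrow> ennreal ((cmod (F n x - f x))\<^sup>2)"
        by (intro tendsto_intros elim)
      then show ?case by (rule lim_imp_Liminf[OF trivial_limit_sequentially, symmetric])
    qed
    also have "\<dots> \<le> liminf (\<lambda>k. \<integral>\<^sup>+x. ennreal ((cmod (F n x - F (r k) x))\<^sup>2) \<partial>lebesgue)"
      by (intro nn_integral_liminf) measurable
    also have "\<dots> \<le> liminf (\<lambda>k. ennreal (((1 / 2) ^ j)\<^sup>2))"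
    proof (rule Liminf_mono, rule eventually_sequentiallyI[of j])
      fix k assume "j \<le> k"
      then show "(\<integral>\<^sup>+x. ennreal ((cmod (F n x - F (r k) x))\<^sup>2) \<partial>lebesgue) \<le> ennreal (((1 / 2) ^ j)\<^sup>2)"
        unfolding norm_F using N[of j n "r k"] r[of j k] that
        by (intro ennreal_leI power_mono) auto
    qed
    also have "\<dots> = ennreal (((1 / 2) ^ j)\<^sup>2)" by (simp add: Liminf_const)
    finally show ?thesis .
  qed
  \<comment> \<open>The limit is square integrable because it differs from one member of the
    sequence by a function of finite norm.\<close>
  have "(\<integral>\<^sup>+x. ennreal ((cmod (F (N 0) x - f x))\<^sup>2) \<partial>lebesgue) < \<infinity>"
    using close[of 0 "N 0"] by (rule le_less_trans) simp_all
  then have "square_integrable (\<lambda>x. F (N 0) x - f x)"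
    unfolding square_integrable_def by (auto intro!: integrableI_bounded)
  from square_integrable_diff[OF F[of "N 0"] this] have f: "square_integrable f" by simp
  have "X \<longlonglongrightarrow> abs_l2 f"
  proof (rule metric_LIMSEQ_I)
    fix e :: real assume "0 < e"
    then obtain j where j: "(1 / 2) ^ j < e" using real_arch_pow_inv[of e "1 / 2"] by auto
    have "dist (X n) (abs_l2 f) < e" if "n \<ge> N j" for n
    proof -
      have "ennreal ((dist (X n) (abs_l2 f))\<^sup>2) \<le> ennreal (((1 / 2) ^ j)\<^sup>2)"
        using close[OF that] nn_integral_norm_abs_l2[OF square_integrable_diff[OF F f], of n]
        by (simp add: abs_l2_diff[OF F f, symmetric] dist_norm) (simp add: F_def)
      then have "(dist (X n) (abs_l2 f))\<^sup>2 \<le> ((1 / 2) ^ j)\<^sup>2" by (subst (asm) ennreal_le_iff) auto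
      then have "dist (X n) (abs_l2 f) \<le> (1 / 2) ^ j" by (rule power2_le_imp_le) simp
      then show ?thesis using j by simp
    qed
    then show "\<exists>M. \<forall>n\<ge>M. dist (X n) (abs_l2 f) < e" by blast
  qed
  then show "convergent X" by (auto simp: convergent_def)
qed

lift_definition times_i :: "'a::euclidean_space l2 \<Rightarrow> 'a l2" is "\<lambda>f x. \<i> * f x"
  unfolding l2_rel_def by (auto intro: square_integrable_mult)

interpretation l2: complex_hilbert times_i
proof
  fix u v :: "'a l2" and r :: real
  show "times_i (u + v) = times_i u + times_i v"
    by transfer (simp add: l2_rel_def square_integrable_add square_integrable_mult distrib_left)
  show "times_i (r *\<^sub>R u) = r *\<^sub>R times_i u"
    by transfer (simp add: l2_rel_def square_integrable_mult mult.left_commute)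
  show "times_i (times_i u) = - u"
    by transfer (simp add: l2_rel_def square_integrable_uminus mult.assoc[symmetric])
  show "inner (times_i u) (times_i v) = inner u v"
    by transfer (simp add: inner_complex_def add.commute)
qed

lemma times_i_abs_l2: "square_integrable f \<Longrightarrow> times_i (abs_l2 f) = abs_l2 (\<lambda>x. \<i> * f x)"
  by (intro times_i.abs_eq l2_rel_self)

lemma cscale_abs_l2:
  assumes "square_integrable f"
  shows "l2.cscale z (abs_l2 f) = abs_l2 (\<lambda>x. z * f x)"
proof -
  have "l2.cscale z (abs_l2 f) = abs_l2 (\<lambda>x. complex_of_real (Re z) * f x + complex_of_real (Im z) * (\<i> * f x))"
    using assms unfolding l2.cscale_def
    by (simp add: times_i_abs_l2 abs_l2_scaleR abs_l2_add square_integrable_mult)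
  moreover have "complex_of_real (Re z) * a + complex_of_real (Im z) * (\<i> * a) = z * a" for a
    by (simp add: complex_eq_iff)
  ultimately show ?thesis by simp
qed

lemma cinner_abs_l2:
  assumes "square_integrable f" "square_integrable g"
  shows "l2.cinner (abs_l2 f) (abs_l2 g) = (LINT x|lebesgue. f x * cnj (g x))"
proof -
  have "l2.cinner (abs_l2 f) (abs_l2 g)
      = Complex (LINT x|lebesgue. Re (f x * cnj (g x))) (LINT x|lebesgue. Im (f x * cnj (g x)))"
    using assms unfolding l2.cinner_def
    by (simp add: times_i_abs_l2 inner_abs_l2 square_integrable_mult inner_complex_def algebra_simps)
  then show ?thesis
    by (simp only: integral_Re[OF integrable_mult_cnj[OF assms]]
        integral_Im[OF integrable_mult_cnj[OF assms]] complex_surj)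
qed

section \<open>Operators on a domain\<close>

definition embed :: "'a::euclidean_space set \<Rightarrow> ('a \<Rightarrow> complex) \<Rightarrow> 'a l2" where
  "embed \<Omega> u = abs_l2 (\<lambda>x. if x \<in> \<Omega> then u x else 0)"

text \<open>For a bounded \<open>S\<close> the part of v outside \<Omega> has no influence, because
  \<open>L2\<close> and \<open>ae_eq\<close> see functions on \<Omega> only; so this is the
  extension by zero on functions vanishing on \<Omega>.\<close>

definition lift_op :: "'a::euclidean_space set \<Rightarrow> 'a oper \<Rightarrow> 'a l2 \<Rightarrow> 'a l2" where
  "lift_op \<Omega> S v = embed \<Omega> (S (rep_l2 v))"

lemma ae_eq_refl: "ae_eq \<Omega> u u"
  by (simp add: ae_eq_def)

lemma ae_eq_sym: "ae_eq \<Omega> u v \<Longrightarrow> ae_eq \<Omega> v u"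
  by (auto simp: ae_eq_def)

lemma ae_eq_trans: "ae_eq \<Omega> u v \<Longrightarrow> ae_eq \<Omega> v w \<Longrightarrow> ae_eq \<Omega> u w"
  unfolding ae_eq_def by (auto elim: AE_mp)

locale lebesgue_domain =
  fixes \<Omega> :: "'a::euclidean_space set"
  assumes sets_\<Omega> [measurable, simp]: "\<Omega> \<in> sets lebesgue"
begin

lemma L2_iff: "u \<in> L2 \<Omega> \<longleftrightarrow> square_integrable (\<lambda>x. if x \<in> \<Omega> then u x else 0)"
proof -
  have "(cmod (if x \<in> \<Omega> then u x else 0))\<^sup>2 = (if x \<in> \<Omega> then (cmod (u x))\<^sup>2 else 0)" for x
    by simp
  then show ?thesis
    by (simp only: L2_def square_integrable_def mem_Collect_eq borel_measurable_if[OF sets_\<Omega>]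
        Lebesgue_Measure.integrable_restrict_UNIV[OF sets_\<Omega>])
qed

lemma L2D: "u \<in> L2 \<Omega> \<Longrightarrow> square_integrable (\<lambda>x. if x \<in> \<Omega> then u x else 0)"
  by (simp add: L2_iff)

lemma L2_square_integrable:
  assumes "square_integrable f" shows "f \<in> L2 \<Omega>"
  unfolding L2_iff
proof (rule square_integrable_bound[OF _ square_integrableD[OF assms]])
  note assms[measurable]
  show "(\<lambda>x. if x \<in> \<Omega> then f x else 0) \<in> borel_measurable lebesgue"
    by (rule measurable_If_set) (use assms sets_\<Omega> in \<open>auto simp: square_integrable_def\<close>)
qed auto

lemma rep_L2 [simp]: "rep_l2 v \<in> L2 \<Omega>"
  by (simp add: L2_square_integrable square_integrable_rep)

lemma L2_add: "u \<in> L2 \<Omega> \<Longrightarrow> v \<in> L2 \<Omega> \<Longrightarrow> (\<lambda>x. u x + v x) \<in> L2 \<Omega>"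
  unfolding L2_iff by (drule (1) square_integrable_add) (erule arg_cong[where f = square_integrable, THEN iffD1, rotated], auto)

lemma L2_cmult: "u \<in> L2 \<Omega> \<Longrightarrow> (\<lambda>x. c * u x) \<in> L2 \<Omega>"
  unfolding L2_iff by (drule square_integrable_mult[of _ c]) (erule arg_cong[where f = square_integrable, THEN iffD1, rotated], auto)

lemma L2_diff: "u \<in> L2 \<Omega> \<Longrightarrow> v \<in> L2 \<Omega> \<Longrightarrow> (\<lambda>x. u x - v x) \<in> L2 \<Omega>"
  using L2_add[OF _ L2_cmult[of v "- 1"]] by simp

lemma L2_sum: "(\<And>i. i \<in> S \<Longrightarrow> f i \<in> L2 \<Omega>) \<Longrightarrow> (\<lambda>x. \<Sum>i\<in>S. f i x) \<in> L2 \<Omega>"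
  by (induction S rule: infinite_finite_induct)
    (auto intro: L2_add L2_square_integrable[OF square_integrable_zero])

lemma embed_eq_iff:
  assumes "u \<in> L2 \<Omega>" "v \<in> L2 \<Omega>"
  shows "embed \<Omega> u = embed \<Omega> v \<longleftrightarrow> ae_eq \<Omega> u v"
proof -
  have "(AE x in lebesgue. (if x \<in> \<Omega> then u x else 0) = (if x \<in> \<Omega> then v x else 0))
      \<longleftrightarrow> (AE x in lebesgue. x \<in> \<Omega> \<longrightarrow> u x = v x)"
    by (intro AE_cong) auto
  then show ?thesis
    by (simp add: embed_def abs_l2_eq_iff[OF L2D[OF assms(1)] L2D[OF assms(2)]] ae_eq_def
        AE_restrict_space_iff)
qed

lemma embed_add:
  assumes "u \<in> L2 \<Omega>" "v \<in> L2 \<Omega>"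
  shows "embed \<Omega> (\<lambda>x. u x + v x) = embed \<Omega> u + embed \<Omega> v"
  unfolding embed_def abs_l2_add[OF L2D[OF assms(1)] L2D[OF assms(2)]]
  by (rule arg_cong[where f = abs_l2]) auto

lemma embed_diff:
  assumes "u \<in> L2 \<Omega>" "v \<in> L2 \<Omega>"
  shows "embed \<Omega> (\<lambda>x. u x - v x) = embed \<Omega> u - embed \<Omega> v"
  unfolding embed_def abs_l2_diff[OF L2D[OF assms(1)] L2D[OF assms(2)]]
  by (rule arg_cong[where f = abs_l2]) auto

lemma embed_cmult:
  assumes "u \<in> L2 \<Omega>"
  shows "embed \<Omega> (\<lambda>x. c * u x) = l2.cscale c (embed \<Omega> u)"
  unfolding embed_def cscale_abs_l2[OF L2D[OF assms]]
  by (rule arg_cong[where f = abs_l2]) auto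

lemma embed_zero: "embed \<Omega> (\<lambda>x. 0) = 0"
  by (simp add: embed_def zero_l2.abs_eq)

lemma embed_sum:
  "(\<And>i. i \<in> S \<Longrightarrow> f i \<in> L2 \<Omega>) \<Longrightarrow> embed \<Omega> (\<lambda>x. \<Sum>i\<in>S. f i x) = (\<Sum>i\<in>S. embed \<Omega> (f i))"
  by (induction S rule: infinite_finite_induct) (auto simp: embed_zero embed_add L2_sum)

lemma norm_embed:
  assumes "u \<in> L2 \<Omega>" shows "norm (embed \<Omega> u) = l2_norm \<Omega> u"
proof -
  have "(cmod (if x \<in> \<Omega> then u x else 0))\<^sup>2 = (if x \<in> \<Omega> then (cmod (u x))\<^sup>2 else 0)" for x
    by simp
  then show ?thesis
    by (simp only: embed_def norm_abs_l2[OF L2D[OF assms]] l2_norm_def Lebesgue_Measure.integral_restrict_UNIV[OF sets_\<Omega>])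
qed

lemma cinner_embed_rep:
  assumes "u \<in> L2 \<Omega>" shows "l2.cinner (embed \<Omega> u) w = l2_inner \<Omega> u (rep_l2 w)"
proof -
  have "l2.cinner (embed \<Omega> u) w = l2.cinner (embed \<Omega> u) (abs_l2 (rep_l2 w))" by simp
  also have "\<dots> = (LINT x|lebesgue. (if x \<in> \<Omega> then u x * cnj (rep_l2 w x) else 0))"
    unfolding embed_def cinner_abs_l2[OF L2D[OF assms] square_integrable_rep]
    by (rule Bochner_Integration.integral_cong) auto
  finally show ?thesis by (simp only: Lebesgue_Measure.integral_restrict_UNIV[OF sets_\<Omega>] l2_inner_def)
qed

lemma cinner_embed:
  assumes "u \<in> L2 \<Omega>" "v \<in> L2 \<Omega>"
  shows "l2.cinner (embed \<Omega> u) (embed \<Omega> v) = l2_inner \<Omega> u v"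
proof -
  have "l2.cinner (embed \<Omega> u) (embed \<Omega> v) = (LINT x|lebesgue. (if x \<in> \<Omega> then u x * cnj (v x) else 0))"
    unfolding embed_def cinner_abs_l2[OF L2D[OF assms(1)] L2D[OF assms(2)]]
    by (rule Bochner_Integration.integral_cong) auto
  then show ?thesis by (simp only: Lebesgue_Measure.integral_restrict_UNIV[OF sets_\<Omega>] l2_inner_def)
qed

lemma ae_eq_rep_abs:
  assumes "square_integrable f" shows "ae_eq \<Omega> (rep_l2 (abs_l2 f)) f"
proof -
  have "AE x in lebesgue. x \<in> \<Omega> \<longrightarrow> rep_l2 (abs_l2 f) x = f x"
    using rep_abs_l2[OF assms] by eventually_elim simp
  then show ?thesis by (simp add: ae_eq_def AE_restrict_space_iff)
qed

lemma ae_eq_rep_embed: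
  assumes "u \<in> L2 \<Omega>" shows "ae_eq \<Omega> (rep_l2 (embed \<Omega> u)) u"
proof (rule ae_eq_trans)
  show "ae_eq \<Omega> (rep_l2 (embed \<Omega> u)) (\<lambda>x. if x \<in> \<Omega> then u x else 0)"
    unfolding embed_def by (intro ae_eq_rep_abs L2D assms)
  show "ae_eq \<Omega> (\<lambda>x. if x \<in> \<Omega> then u x else 0) u"
    by (simp add: ae_eq_def AE_restrict_space_iff)
qed

lemma ae_eq_rep_add: "ae_eq \<Omega> (rep_l2 (u + v)) (\<lambda>x. rep_l2 u x + rep_l2 v x)"
  using ae_eq_rep_abs[OF square_integrable_add[OF square_integrable_rep square_integrable_rep], of u v]
  by (simp add: abs_l2_add[symmetric] square_integrable_rep)

lemma ae_eq_rep_cscale: "ae_eq \<Omega> (rep_l2 (l2.cscale c u)) (\<lambda>x. c * rep_l2 u x)"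
  using ae_eq_rep_abs[OF square_integrable_mult[OF square_integrable_rep], of c u]
  by (simp add: cscale_abs_l2[symmetric] square_integrable_rep)

lemma norm_embed_rep_le: "norm (embed \<Omega> (rep_l2 w)) \<le> norm w"
proof -
  have "(LINT x|lebesgue. (cmod (if x \<in> \<Omega> then rep_l2 w x else 0))\<^sup>2)
      \<le> (LINT x|lebesgue. (cmod (rep_l2 w x))\<^sup>2)"
    by (intro integral_mono square_integrableD L2D rep_L2 square_integrable_rep) auto
  then have "norm (embed \<Omega> (rep_l2 w)) \<le> norm (abs_l2 (rep_l2 w))"
    by (simp only: embed_def norm_abs_l2[OF L2D[OF rep_L2]] norm_abs_l2[OF square_integrable_rep]
        real_sqrt_le_iff)
  then show ?thesis by simp
qed

lemma embed_rep_embed: "u \<in> L2 \<Omega> \<Longrightarrow> embed \<Omega> (rep_l2 (embed \<Omega> u)) = embed \<Omega> u"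
  by (simp add: embed_eq_iff ae_eq_rep_embed)

lemma subspace_range_embed: "subspace (embed \<Omega> ` L2 \<Omega>)"
proof (rule subspaceI)
  show "0 \<in> embed \<Omega> ` L2 \<Omega>"
    using embed_zero L2_square_integrable[OF square_integrable_zero] by force
  show "u + v \<in> embed \<Omega> ` L2 \<Omega>" if "u \<in> embed \<Omega> ` L2 \<Omega>" "v \<in> embed \<Omega> ` L2 \<Omega>" for u v
    using that by (auto simp: embed_add[symmetric] L2_add)
  show "r *\<^sub>R u \<in> embed \<Omega> ` L2 \<Omega>" if "u \<in> embed \<Omega> ` L2 \<Omega>" for r u
  proof -
    obtain w where "w \<in> L2 \<Omega>" "u = embed \<Omega> w" using \<open>u \<in> embed \<Omega> ` L2 \<Omega>\<close> by blast
    then have "r *\<^sub>R u = embed \<Omega> (\<lambda>x. complex_of_real r * w x)" by (simp add: embed_cmult)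
    then show ?thesis using L2_cmult[OF \<open>w \<in> L2 \<Omega>\<close>] by blast
  qed
qed

lemma bounded_opD:
  assumes "bounded_op \<Omega> S"
  shows "u \<in> L2 \<Omega> \<Longrightarrow> S u \<in> L2 \<Omega>"
    "u \<in> L2 \<Omega> \<Longrightarrow> v \<in> L2 \<Omega> \<Longrightarrow> ae_eq \<Omega> u v \<Longrightarrow> ae_eq \<Omega> (S u) (S v)"
    "u \<in> L2 \<Omega> \<Longrightarrow> v \<in> L2 \<Omega> \<Longrightarrow> ae_eq \<Omega> (S (\<lambda>x. u x + v x)) (\<lambda>x. S u x + S v x)"
    "u \<in> L2 \<Omega> \<Longrightarrow> ae_eq \<Omega> (S (\<lambda>x. c * u x)) (\<lambda>x. c * S u x)"
  using assms by (simp_all add: bounded_op_def)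

lemma bounded_op_bound:
  assumes "bounded_op \<Omega> S"
  obtains C where "C > 0" "\<And>u. u \<in> L2 \<Omega> \<Longrightarrow> l2_norm \<Omega> (S u) \<le> C * l2_norm \<Omega> u"
proof -
  obtain C where C: "\<And>u. u \<in> L2 \<Omega> \<Longrightarrow> l2_norm \<Omega> (S u) \<le> C * l2_norm \<Omega> u"
    using assms unfolding bounded_op_def by blast
  have "l2_norm \<Omega> (S u) \<le> max C 1 * l2_norm \<Omega> u" if "u \<in> L2 \<Omega>" for u
    using C[OF that] norm_embed[OF that] by (smt (verit) max.cobounded1 mult_right_mono norm_ge_zero)
  then show thesis by (intro that[of "max C 1"]) auto
qed

lemma lift_op_embed:
  assumes "bounded_op \<Omega> S" "u \<in> L2 \<Omega>"
  shows "lift_op \<Omega> S (embed \<Omega> u) = embed \<Omega> (S u)"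
  unfolding lift_op_def using assms
  by (intro embed_eq_iff[THEN iffD2] bounded_opD(1,2)[OF assms(1)] ae_eq_rep_embed) auto

lemma lift_op_bound:
  assumes "bounded_op \<Omega> S" and C: "C \<ge> 0" "\<And>u. u \<in> L2 \<Omega> \<Longrightarrow> l2_norm \<Omega> (S u) \<le> C * l2_norm \<Omega> u"
  shows "norm (lift_op \<Omega> S v) \<le> C * norm v"
proof -
  have "norm (lift_op \<Omega> S v) \<le> C * norm (embed \<Omega> (rep_l2 v))"
    using C by (simp add: lift_op_def norm_embed bounded_opD[OF assms(1)])
  also have "\<dots> \<le> C * norm v" using C by (intro mult_left_mono norm_embed_rep_le)
  finally show ?thesis .
qed

lemma clinear_lift_op:
  assumes S: "bounded_op \<Omega> S" shows "l2.clinear (lift_op \<Omega> S)"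
proof -
  note [simp] = bounded_opD(1)[OF S]
  have add: "lift_op \<Omega> S (u + v) = lift_op \<Omega> S u + lift_op \<Omega> S v" for u v
  proof -
    have "ae_eq \<Omega> (S (rep_l2 (u + v))) (\<lambda>x. S (rep_l2 u) x + S (rep_l2 v) x)"
      by (rule ae_eq_trans[OF bounded_opD(2)[OF S _ _ ae_eq_rep_add] bounded_opD(3)[OF S]])
        (auto simp: L2_add)
    then show ?thesis
      by (simp add: lift_op_def embed_add[symmetric] embed_eq_iff L2_add)
  qed
  have cscale: "lift_op \<Omega> S (l2.cscale c u) = l2.cscale c (lift_op \<Omega> S u)" for c u
  proof -
    have "ae_eq \<Omega> (S (rep_l2 (l2.cscale c u))) (\<lambda>x. c * S (rep_l2 u) x)"
      by (rule ae_eq_trans[OF bounded_opD(2)[OF S _ _ ae_eq_rep_cscale] bounded_opD(4)[OF S]])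
        (auto simp: L2_cmult)
    then show ?thesis
      by (simp add: lift_op_def embed_cmult[symmetric] embed_eq_iff L2_cmult)
  qed
  obtain C where C: "C > 0" "\<And>u. u \<in> L2 \<Omega> \<Longrightarrow> l2_norm \<Omega> (S u) \<le> C * l2_norm \<Omega> u"
    using bounded_op_bound[OF S] by blast
  show ?thesis
    unfolding l2.clinear_def
  proof (intro conjI allI bounded_linear_intro[where K = C])
    show "lift_op \<Omega> S (r *\<^sub>R u) = r *\<^sub>R lift_op \<Omega> S u" for r u
      using cscale[of "complex_of_real r" u] by simp
    show "norm (lift_op \<Omega> S v) \<le> norm v * C" for v
      using lift_op_bound[OF S _ C(2), of v] C(1) by (simp add: mult.commute)
    show "lift_op \<Omega> S (times_i u) = times_i (lift_op \<Omega> S u)" for u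
      using cscale[of \<i> u] by simp
  qed (rule add)
qed

lemma bounded_op_id: "bounded_op \<Omega> (\<lambda>u. u)"
  unfolding bounded_op_def by (auto intro!: ae_eq_refl exI[of _ 1])

text \<open>The way back from the Hilbert space to operators on representatives, used for resolvents
  and for the operator T^(2+\<epsilon>).\<close>

lemma bounded_op_of_clinear:
  assumes B: "l2.clinear B" shows "bounded_op \<Omega> (\<lambda>u. rep_l2 (B (embed \<Omega> u)))"
  unfolding bounded_op_def
proof (intro conjI ballI allI impI)
  fix u v assume uv: "u \<in> L2 \<Omega>" "v \<in> L2 \<Omega>"
  show "ae_eq \<Omega> (rep_l2 (B (embed \<Omega> u))) (rep_l2 (B (embed \<Omega> v)))" if "ae_eq \<Omega> u v"
    using that uv embed_eq_iff by (metis ae_eq_refl)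
  show "ae_eq \<Omega> (rep_l2 (B (embed \<Omega> (\<lambda>x. u x + v x))))
      (\<lambda>x. rep_l2 (B (embed \<Omega> u)) x + rep_l2 (B (embed \<Omega> v)) x)"
    using uv by (simp add: embed_add l2.clinearD[OF B] ae_eq_rep_add)
next
  fix u c assume u: "u \<in> L2 \<Omega>"
  show "ae_eq \<Omega> (rep_l2 (B (embed \<Omega> (\<lambda>x. c * u x)))) (\<lambda>x. c * rep_l2 (B (embed \<Omega> u)) x)"
    using u by (simp add: embed_cmult l2.clinearD[OF B] ae_eq_rep_cscale)
next
  interpret bounded_linear B using B by (rule l2.clinearD)
  obtain K where K: "\<And>u. norm (B u) \<le> norm u * K" using bounded by blast
  have "l2_norm \<Omega> (rep_l2 (B (embed \<Omega> u))) \<le> K * l2_norm \<Omega> u" if "u \<in> L2 \<Omega>" for u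
    using norm_embed_rep_le[of "B (embed \<Omega> u)"] K[of "embed \<Omega> u"] that
    by (simp add: norm_embed mult.commute)
  then show "\<exists>C. \<forall>u\<in>L2 \<Omega>. l2_norm \<Omega> (rep_l2 (B (embed \<Omega> u))) \<le> C * l2_norm \<Omega> u" by blast
qed simp

lemma funpow_embed:
  assumes T: "bounded_op \<Omega> T" and u: "u \<in> L2 \<Omega>"
  shows "(T ^^ i) u \<in> L2 \<Omega>" "embed \<Omega> ((T ^^ i) u) = (lift_op \<Omega> T ^^ i) (embed \<Omega> u)"
proof -
  show L2: "(T ^^ i) u \<in> L2 \<Omega>" for i by (induction i) (auto simp: u bounded_opD[OF T])
  show "embed \<Omega> ((T ^^ i) u) = (lift_op \<Omega> T ^^ i) (embed \<Omega> u)"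
    by (induction i) (auto simp: lift_op_embed[OF T L2, symmetric])
qed

lemma poly_op_embed:
  assumes T: "bounded_op \<Omega> T" and u: "u \<in> L2 \<Omega>"
  shows "poly_op p T u \<in> L2 \<Omega>" "embed \<Omega> (poly_op p T u) = l2.polyop p (lift_op \<Omega> T) (embed \<Omega> u)"
  unfolding poly_op_def l2.polyop_def
  by (auto intro!: L2_sum L2_cmult sum.cong simp: embed_sum embed_cmult L2_cmult funpow_embed[OF T u])

text \<open>For an unbounded map \<open>op_norm\<close> is the junk value \<open>Inf {}\<close>; hence the a priori bounds.\<close>

lemma op_norm_le:
  assumes "C \<ge> 0" "\<And>u. u \<in> L2 \<Omega> \<Longrightarrow> l2_norm \<Omega> (D u) \<le> C * l2_norm \<Omega> u"
  shows "0 \<le> op_norm \<Omega> D" "op_norm \<Omega> D \<le> C"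
  unfolding op_norm_def using assms
  by (auto intro!: cInf_greatest cInf_lower bdd_belowI[of _ 0])

lemma le_op_norm:
  assumes "C \<ge> 0" "\<And>u. u \<in> L2 \<Omega> \<Longrightarrow> l2_norm \<Omega> (D u) \<le> C * l2_norm \<Omega> u" and u: "u \<in> L2 \<Omega>"
  shows "l2_norm \<Omega> (D u) \<le> op_norm \<Omega> D * l2_norm \<Omega> u"
proof (cases "l2_norm \<Omega> u = 0")
  case True
  then show ?thesis using assms(2)[OF u] by simp
next
  case False
  then have pos: "l2_norm \<Omega> u > 0" using norm_embed[OF u] by (metis norm_ge_zero less_eq_real_def)
  have "l2_norm \<Omega> (D u) / l2_norm \<Omega> u \<le> op_norm \<Omega> D"
    unfolding op_norm_def using assms pos
    by (intro cInf_greatest) (auto simp: divide_le_eq)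
  then show ?thesis using pos by (simp add: divide_le_eq)
qed

text \<open>The resolvent is a bounded left inverse. The estimate is confined to the range of
  \<open>embed\<close>: at z = 0 it fails for any nonzero function vanishing on \<Omega>, which the
  lifted operator maps to 0.\<close>

lemma bounded_below_of_not_spectrum:
  assumes T: "bounded_op \<Omega> T" and z: "z \<notin> op_spectrum \<Omega> T"
  obtains c where "c \<ge> 0"
    "\<And>v. v \<in> embed \<Omega> ` L2 \<Omega> \<Longrightarrow> norm v \<le> c * norm (lift_op \<Omega> T v - l2.cscale z v)"
proof -
  obtain R where R: "bounded_op \<Omega> R" "\<And>u. u \<in> L2 \<Omega> \<Longrightarrow> ae_eq \<Omega> (R (\<lambda>x. T u x - z * u x)) u"
    using z by (auto simp: op_spectrum_def)
  obtain C where C: "C > 0" "\<And>u. u \<in> L2 \<Omega> \<Longrightarrow> l2_norm \<Omega> (R u) \<le> C * l2_norm \<Omega> u"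
    using bounded_op_bound[OF R(1)] by blast
  have "norm (embed \<Omega> u) \<le> C * norm (lift_op \<Omega> T (embed \<Omega> u) - l2.cscale z (embed \<Omega> u))"
    if u: "u \<in> L2 \<Omega>" for u
  proof -
    define w where "w = (\<lambda>x. T u x - z * u x)"
    have w: "w \<in> L2 \<Omega>" unfolding w_def by (intro L2_diff L2_cmult bounded_opD[OF T] u)
    have "embed \<Omega> u = embed \<Omega> (R w)"
      using R(2)[OF u] u w by (subst embed_eq_iff) (auto simp: w_def[symmetric] bounded_opD[OF R(1)] intro: ae_eq_sym)
    also have "norm \<dots> \<le> C * norm (embed \<Omega> w)"
      using C(2)[OF w] w by (simp add: norm_embed bounded_opD[OF R(1)])
    also have "embed \<Omega> w = lift_op \<Omega> T (embed \<Omega> u) - l2.cscale z (embed \<Omega> u)"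
      unfolding w_def by (simp add: embed_diff embed_cmult lift_op_embed[OF T] u L2_cmult bounded_opD[OF T])
    finally show ?thesis .
  qed
  then show thesis using C(1) by (intro that[of C]) auto
qed

lemma not_spectrum_of_resolvent:
  assumes T: "bounded_op \<Omega> T" and B: "l2.clinear B"
    and RA: "\<And>v. B (lift_op \<Omega> T v - l2.cscale z v) = v"
    and AR: "\<And>v. lift_op \<Omega> T (B v) - l2.cscale z (B v) = v"
  shows "z \<notin> op_spectrum \<Omega> T"
proof -
  let ?R = "\<lambda>u. rep_l2 (B (embed \<Omega> u))"
  have "ae_eq \<Omega> (?R (\<lambda>x. T u x - z * u x)) u" if u: "u \<in> L2 \<Omega>" for u
  proof -
    have "embed \<Omega> (\<lambda>x. T u x - z * u x) = lift_op \<Omega> T (embed \<Omega> u) - l2.cscale z (embed \<Omega> u)"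
      by (simp add: embed_diff embed_cmult lift_op_embed[OF T] u L2_cmult bounded_opD[OF T])
    then show ?thesis using ae_eq_rep_embed[OF u] by (simp add: RA)
  qed
  moreover have "ae_eq \<Omega> (\<lambda>x. T (?R u) x - z * ?R u x) u" if u: "u \<in> L2 \<Omega>" for u
  proof -
    let ?v = "B (embed \<Omega> u)"
    \<comment> \<open>The projection that cuts functions off outside \<Omega>. The vector
      \<open>?v\<close> lives on the whole space while \<open>?R u\<close> is compared on \<Omega>
      only, so the resolvent equation is projected first.\<close>
    let ?E = "lift_op \<Omega> (\<lambda>u. u)"
    have E: "?E (embed \<Omega> w) = embed \<Omega> w" if "w \<in> L2 \<Omega>" for w
      using that by (simp add: lift_op_def embed_rep_embed)
    have "?E (lift_op \<Omega> T ?v - l2.cscale z ?v) = ?E (embed \<Omega> u)" by (simp only: AR)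
    then have "lift_op \<Omega> T ?v - l2.cscale z (embed \<Omega> (rep_l2 ?v)) = embed \<Omega> u"
      using u by (simp add: l2.clinearD[OF clinear_lift_op[OF bounded_op_id]] E)
        (simp add: lift_op_def embed_rep_embed bounded_opD[OF T])
    then have "embed \<Omega> (\<lambda>x. T (?R u) x - z * ?R u x) = embed \<Omega> u"
      by (simp add: lift_op_def embed_diff embed_cmult L2_cmult bounded_opD[OF T])
    then show ?thesis
      by (subst (asm) embed_eq_iff) (auto intro!: L2_diff L2_cmult bounded_opD[OF T] u)
  qed
  ultimately show ?thesis
    using bounded_op_of_clinear[OF B] unfolding op_spectrum_def by blast
qed

end

section \<open>Positive operators into the continuous functions\<close>

text \<open>Vanishing at 0 lets q(T) factor through T; invariance under conjugation of the
  coefficients makes q(T) symmetric.\<close>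

lemma weierstrass_powr:
  fixes M \<epsilon> :: real
  assumes "\<epsilon> > 0"
  obtains q :: "nat \<Rightarrow> complex poly" where
    "\<And>n. poly (q n) 0 = 0" "\<And>n. map_poly cnj (q n) = q n"
    "\<And>n t. t \<in> {0..M} \<Longrightarrow>
       cmod (poly (q n) (complex_of_real t) - complex_of_real (t powr \<epsilon>)) \<le> 1 / real (Suc n)"
proof -
  have "\<exists>q :: complex poly. poly q 0 = 0 \<and> map_poly cnj q = q \<and> (\<forall>t\<in>{0..M}.
      cmod (poly q (complex_of_real t) - complex_of_real (t powr \<epsilon>)) \<le> e)" if "e > 0" for e :: real
  proof (cases "M \<ge> 0")
    case False
    then show ?thesis by (intro exI[of _ 0]) auto
  next
    case True
    have cont: "continuous_on {0..M} (\<lambda>t. t powr \<epsilon>)"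
      using assms by (intro continuous_on_powr' continuous_intros) auto
    obtain g where g: "real_polynomial_function g" "\<And>t. t \<in> {0..M} \<Longrightarrow> \<bar>t powr \<epsilon> - g t\<bar> < e / 2"
      by (rule Stone_Weierstrass_real_polynomial_function[OF compact_Icc cont half_gt_zero[OF \<open>e > 0\<close>]]) blast
    then obtain a n where a: "g = (\<lambda>t. \<Sum>i\<le>n. a i * t ^ i)"
      by (auto simp: real_polynomial_function_iff_sum)
    define p where "p = (\<Sum>i\<le>n. monom (a i) i) - [:g 0:]"
    define q where "q = map_poly complex_of_real p"
    have p: "poly p t = g t - g 0" for t by (simp add: p_def a poly_sum poly_monom)
    have q: "poly (map_poly complex_of_real r) (complex_of_real t) = complex_of_real (poly r t)" for r t
      by (induction r) (auto simp: map_poly_pCons)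
    have "poly q 0 = 0" using q[of p 0] p[of 0] by (simp add: q_def)
    moreover have "map_poly cnj q = q" by (rule poly_eqI) (simp add: q_def coeff_map_poly)
    moreover have "cmod (poly q (complex_of_real t) - complex_of_real (t powr \<epsilon>)) \<le> e" if "t \<in> {0..M}" for t
    proof -
      have "poly q (complex_of_real t) - complex_of_real (t powr \<epsilon>) = complex_of_real (g t - g 0 - t powr \<epsilon>)"
        by (simp add: q_def q p)
      moreover have "\<bar>g t - g 0 - t powr \<epsilon>\<bar> \<le> e"
      proof -
        \<comment> \<open>As \<open>0 powr \<epsilon> = 0\<close>, the error of \<open>g\<close> at
          0 is |g 0|; subtracting the constant term costs the second half of e.\<close>
        have "\<bar>g 0\<bar> < e / 2" using g(2)[of 0] True by simp
        then show ?thesis using g(2)[OF that] by linarith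
      qed
      ultimately show ?thesis by (metis norm_of_real real_norm_def)
    qed
    ultimately show ?thesis by blast
  qed
  then have "\<forall>n. \<exists>q :: complex poly. poly q 0 = 0 \<and> map_poly cnj q = q \<and> (\<forall>t\<in>{0..M}.
      cmod (poly q (complex_of_real t) - complex_of_real (t powr \<epsilon>)) \<le> 1 / real (Suc n))" by simp
  then show thesis using that by metis
qed

lemma (in complex_hilbert) cinner_symmetric:
  assumes "clinear A" "\<And>u v. inner (A u) v = inner u (A v)"
  shows "cinner (A u) v = cinner u (A v)"
  using assms by (simp add: cinner_def clinearD(4)[OF assms(1), symmetric])

context lebesgue_domain
begin

lemma integrable_mult_L2:
  assumes "u \<in> L2 \<Omega>" "v \<in> L2 \<Omega>"
  shows "integrable (lebesgue_on \<Omega>) (\<lambda>x. u x * cnj (v x))"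
proof -
  have "(\<lambda>x. (if x \<in> \<Omega> then u x else 0) * cnj (if x \<in> \<Omega> then v x else 0))
      = (\<lambda>x. if x \<in> \<Omega> then u x * cnj (v x) else 0)" by auto
  then show ?thesis
    using integrable_mult_cnj[OF L2D[OF assms(1)] L2D[OF assms(2)]]
    by (simp only: Lebesgue_Measure.integrable_restrict_UNIV[OF sets_\<Omega>])
qed

lemma L2_cong_ae:
  assumes "u \<in> L2 \<Omega>" "ae_eq \<Omega> u v" and [measurable]: "v \<in> borel_measurable (lebesgue_on \<Omega>)"
  shows "v \<in> L2 \<Omega>"
proof -
  have [measurable]: "u \<in> borel_measurable (lebesgue_on \<Omega>)" and "integrable (lebesgue_on \<Omega>) (\<lambda>x. (cmod (u x))\<^sup>2)"
    using assms(1) by (auto simp: L2_def)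
  moreover have "AE x in lebesgue_on \<Omega>. (cmod (u x))\<^sup>2 = (cmod (v x))\<^sup>2"
    using assms(2) unfolding ae_eq_def by eventually_elim simp
  ultimately have "integrable (lebesgue_on \<Omega>) (\<lambda>x. (cmod (v x))\<^sup>2)"
    by (subst integrable_cong_AE[where g = "\<lambda>x. (cmod (u x))\<^sup>2"]) auto
  then show ?thesis by (simp add: L2_def)
qed

lemma inner_lift_op:
  assumes "bounded_op \<Omega> T"
  shows "inner (lift_op \<Omega> T u) v = Re (l2_inner \<Omega> (T (rep_l2 u)) (rep_l2 v))"
  using cinner_embed_rep[of "T (rep_l2 u)" v] bounded_opD(1)[OF assms rep_L2]
  by (metis l2.cinner_def complex.sel(1) lift_op_def)

end

locale smoothing_operator =
  fixes \<Omega> :: "'a::euclidean_space set" and T :: "'a oper" and M :: real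
  assumes open_\<Omega>: "open \<Omega>" and bounded_\<Omega>: "bounded \<Omega>"
    and bounded_T: "bounded_op \<Omega> T" and positive_T: "positive_op \<Omega> T"
    and M: "M > 0" "\<And>u. u \<in> L2 \<Omega> \<Longrightarrow> l2_norm \<Omega> (T u) \<le> M * l2_norm \<Omega> u"
    and range_T: "\<And>u. u \<in> L2 \<Omega> \<Longrightarrow> in_C \<Omega> (T u)"
begin

sublocale lebesgue_domain \<Omega>
  by unfold_locales (simp add: open_\<Omega>)

abbreviation A :: "'a l2 \<Rightarrow> 'a l2" where "A \<equiv> lift_op \<Omega> T"

lemma A_symmetric: "inner (A u) v = inner u (A v)"
proof -
  have "l2_inner \<Omega> (T (rep_l2 u)) (rep_l2 v) = l2_inner \<Omega> (rep_l2 u) (T (rep_l2 v))"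
    using positive_T by (simp add: positive_op_def self_adjoint_op_def)
  also have "\<dots> = cnj (l2_inner \<Omega> (T (rep_l2 v)) (rep_l2 u))"
    unfolding l2_inner_def by (subst Bochner_Integration.integral_cnj[symmetric]) (simp add: mult.commute)
  finally show ?thesis
    by (simp add: inner_lift_op[OF bounded_T] inner_commute[of u])
qed

sublocale pos: positive_operator times_i A M
proof
  show "l2.clinear A" by (rule clinear_lift_op[OF bounded_T])
  show "inner (A u) v = inner u (A v)" for u v by (rule A_symmetric)
  show "0 \<le> inner (A u) u" for u
    using positive_T by (simp add: inner_lift_op[OF bounded_T] positive_op_def complex_nonneg_Reals_iff)
  show "norm (A u) \<le> M * norm u" for u
    using M by (intro lift_op_bound[OF bounded_T]) auto
qed (use M in auto)

sublocale dom: operator_on_subspace times_i A "embed \<Omega> ` L2 \<Omega>"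
proof
  show "subspace (embed \<Omega> ` L2 \<Omega>)" by (rule subspace_range_embed)
  show "times_i u \<in> embed \<Omega> ` L2 \<Omega>" if u: "u \<in> embed \<Omega> ` L2 \<Omega>" for u
  proof -
    obtain w where "w \<in> L2 \<Omega>" "u = embed \<Omega> w" using u by blast
    then have "times_i u = embed \<Omega> (\<lambda>x. \<i> * w x)" by (simp add: embed_cmult)
    then show ?thesis using L2_cmult[OF \<open>w \<in> L2 \<Omega>\<close>] by blast
  qed
  show "A u \<in> embed \<Omega> ` L2 \<Omega>" for u
    by (simp add: lift_op_def bounded_opD[OF bounded_T])
qed (use pos.clinear_T A_symmetric in auto)

lemma spectrum_subset: "op_spectrum \<Omega> T \<subseteq> complex_of_real ` {0..M}"
proof
  fix z assume z: "z \<in> op_spectrum \<Omega> T"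
  show "z \<in> complex_of_real ` {0..M}"
  proof (rule ccontr)
    assume "\<not> ?thesis"
    then obtain R where "l2.clinear R" "\<And>u. R (A u - l2.cscale z u) = u"
        "\<And>u. A (R u) - l2.cscale z (R u) = u"
      using pos.resolvent_exists by metis
    then show False using not_spectrum_of_resolvent[OF bounded_T] z by blast
  qed
qed

text \<open>The bound uses values on the spectrum itself, the only place where
  \<open>is_fun_calc\<close> controls its polynomials.\<close>

lemma polyop_le_spectrum:
  assumes "B \<ge> 0" "\<And>z. z \<in> op_spectrum \<Omega> T \<Longrightarrow> cmod (poly p z) \<le> B" "u \<in> embed \<Omega> ` L2 \<Omega>"
  shows "norm (l2.polyop p A u) \<le> B * norm u"
proof (rule dom.polyop_bounded_by_spectrum[OF _ _ assms])
  show "dom.bounded_below (\<lambda>u. A u - l2.cscale z u)" if "z \<notin> op_spectrum \<Omega> T" for z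
    using bounded_below_of_not_spectrum[OF bounded_T that] unfolding dom.bounded_below_def by metis
  show "op_spectrum \<Omega> T \<subseteq> \<real>" using spectrum_subset by auto
qed

subsection \<open>Point evaluations\<close>

definition ev :: "'a l2 \<Rightarrow> 'a \<Rightarrow> complex" where
  "ev w = cont_rep \<Omega> (T (rep_l2 w))"

lemma is_cont_rep_ev: "is_cont_rep \<Omega> (T (rep_l2 w)) (ev w)"
  using range_T[OF rep_L2] unfolding ev_def cont_rep_def in_C_def by (rule someI_ex)

lemma continuous_ev: "continuous_on (closure \<Omega>) (ev w)"
  using is_cont_rep_ev by (auto simp: is_cont_rep_def)

lemma ae_eq_ev: "ae_eq \<Omega> (T (rep_l2 w)) (ev w)"
  using is_cont_rep_ev by (auto simp: is_cont_rep_def)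

lemma continuous_ev_interior: "continuous_on \<Omega> (ev w)"
  by (rule continuous_on_subset[OF continuous_ev closure_subset])

lemma ev_measurable [measurable]: "ev w \<in> borel_measurable (lebesgue_on \<Omega>)"
  by (intro continuous_imp_measurable_on_sets_lebesgue continuous_ev_interior sets_\<Omega>)

lemma ev_L2 [simp]: "ev w \<in> L2 \<Omega>"
  using L2_cong_ae[OF bounded_opD(1)[OF bounded_T rep_L2] ae_eq_ev ev_measurable] .

lemma embed_ev: "embed \<Omega> (ev w) = A w"
  unfolding lift_op_def
  by (intro embed_eq_iff[THEN iffD2] ev_L2 bounded_opD(1)[OF bounded_T] rep_L2 ae_eq_sym[OF ae_eq_ev])

text \<open>Transfers identities between classes to identities at every point of the closure; the
  linearity of \<open>ev\<close> at a point rests on it.\<close>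

lemma continuous_embed_unique:
  assumes "continuous_on (closure \<Omega>) g" "g \<in> L2 \<Omega>" "embed \<Omega> g = A w" "x \<in> closure \<Omega>"
  shows "ev w x = g x"
proof (rule is_cont_rep_unique[OF open_\<Omega> _ _ assms(4)])
  have "ae_eq \<Omega> g (ev w)"
    using assms embed_ev embed_eq_iff[OF assms(2) ev_L2[of w]] by simp
  then show "is_cont_rep \<Omega> g (ev w)" by (simp add: is_cont_rep_def continuous_ev)
  show "is_cont_rep \<Omega> g g" by (simp add: is_cont_rep_def assms(1) ae_eq_refl)
qed

lemma ev_add: "x \<in> closure \<Omega> \<Longrightarrow> ev (u + v) x = ev u x + ev v x"
  using continuous_embed_unique[of "\<lambda>y. ev u y + ev v y" "u + v" x]
  by (simp add: continuous_on_add continuous_ev L2_add embed_add embed_ev l2.clinearD(1)[OF pos.clinear_T])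

lemma ev_diff: "x \<in> closure \<Omega> \<Longrightarrow> ev (u - v) x = ev u x - ev v x"
  using continuous_embed_unique[of "\<lambda>y. ev u y - ev v y" "u - v" x]
  by (simp add: continuous_on_diff continuous_ev L2_diff embed_diff embed_ev l2.clinearD(2)[OF pos.clinear_T])

lemma ev_cscale: "x \<in> closure \<Omega> \<Longrightarrow> ev (l2.cscale c u) x = c * ev u x"
  using continuous_embed_unique[of "\<lambda>y. c * ev u y" "l2.cscale c u" x]
  by (simp add: continuous_on_mult_left continuous_ev L2_cmult embed_cmult embed_ev l2.clinearD(5)[OF pos.clinear_T])

lemma finite_measure_\<Omega>: "finite_measure (lebesgue_on \<Omega>)"
proof (rule finite_measureI)
  have "emeasure lebesgue \<Omega> < \<infinity>"
    using bounded_\<Omega> sets_\<Omega> bounded_set_imp_lmeasurable by (metis fmeasurableD2 infinity_ennreal_def less_top)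
  then show "emeasure (lebesgue_on \<Omega>) (space (lebesgue_on \<Omega>)) \<noteq> \<infinity>"
    by (simp add: emeasure_restrict_space)
qed

text \<open>Pairing with \<open>\<phi>\<close> takes the mean over S, which lies between the bounds
  of the values there.\<close>

lemma mean_value_bounds:
  assumes S: "S \<in> sets (lebesgue_on \<Omega>)" and pos: "measure (lebesgue_on \<Omega>) S > 0"
    and g: "g \<in> L2 \<Omega>" and ab: "\<And>x. x \<in> S \<Longrightarrow> a \<le> Re (g x)" "\<And>x. x \<in> S \<Longrightarrow> Re (g x) \<le> b"
  defines "\<phi> \<equiv> (\<lambda>x. complex_of_real (indicator S x / measure (lebesgue_on \<Omega>) S))"
  shows "\<phi> \<in> L2 \<Omega>" "a \<le> Re (l2_inner \<Omega> g \<phi>)" "Re (l2_inner \<Omega> g \<phi>) \<le> b"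
proof -
  interpret finite_measure "lebesgue_on \<Omega>" by (rule finite_measure_\<Omega>)
  let ?m = "measure (lebesgue_on \<Omega>) S"
  note [measurable] = S
  have ind: "integrable (lebesgue_on \<Omega>) (\<lambda>x. c * indicator S x :: real)"
    "(LINT x|lebesgue_on \<Omega>. c * indicator S x) = c * ?m" for c
    using S sets.sets_into_space[OF S] by (auto simp: less_top emeasure_eq_measure Int_absorb2)
  have "(\<lambda>x. (cmod (\<phi> x))\<^sup>2) = (\<lambda>x. (1 / ?m)\<^sup>2 * indicator S x)"
    using pos by (auto simp: \<phi>_def indicator_def norm_divide power_divide)
  moreover have "\<phi> \<in> borel_measurable (lebesgue_on \<Omega>)" unfolding \<phi>_def by measurable
  ultimately show \<phi>: "\<phi> \<in> L2 \<Omega>" using ind(1) by (simp add: L2_def)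
  have *: "Re (g x * cnj (\<phi> x)) = Re (g x) / ?m * indicator S x" for x
    by (simp add: \<phi>_def)
  have int: "integrable (lebesgue_on \<Omega>) (\<lambda>x. Re (g x) / ?m * indicator S x)"
    using integrable_Re[OF integrable_mult_L2[OF g \<phi>]] by (simp only: *)
  have R: "Re (l2_inner \<Omega> g \<phi>) = (LINT x|lebesgue_on \<Omega>. Re (g x) / ?m * indicator S x)"
    unfolding l2_inner_def integral_Re[OF integrable_mult_L2[OF g \<phi>], symmetric] by (simp only: *)
  have "(LINT x|lebesgue_on \<Omega>. a / ?m * indicator S x) \<le> Re (l2_inner \<Omega> g \<phi>)"
    unfolding R using ab pos by (intro integral_mono ind int) (auto simp: indicator_def divide_right_mono)
  then show "a \<le> Re (l2_inner \<Omega> g \<phi>)" using pos by (simp only: ind) simp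
  have "Re (l2_inner \<Omega> g \<phi>) \<le> (LINT x|lebesgue_on \<Omega>. b / ?m * indicator S x)"
    unfolding R using ab pos by (intro integral_mono ind int) (auto simp: indicator_def divide_right_mono)
  then show "Re (l2_inner \<Omega> g \<phi>) \<le> b" using pos by (simp only: ind) simp
qed

text \<open>Instead of the closed graph theorem: the means of \<open>T u\<close> over sets of positive measure are
  the functionals \<open>u \<mapsto> (u, T \<phi>)\<close>, which are pointwise bounded because \<open>T u\<close> is a bounded function.\<close>

lemma ev_bounded: "\<exists>C\<ge>0. \<forall>x\<in>closure \<Omega>. \<forall>w. cmod (ev w x) \<le> C * norm w"
proof -
  let ?P = "lebesgue_on \<Omega>"
  interpret finite_measure ?P by (rule finite_measure_\<Omega>)
  define \<phi> where "\<phi> S x = complex_of_real (indicator S x / measure ?P S)" for S and x :: 'a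
  define W where "W = {A (embed \<Omega> (\<phi> S)) |S. S \<in> sets ?P \<and> measure ?P S > 0}"
  have inner_eq: "inner u (A (embed \<Omega> (\<phi> S))) = Re (l2_inner \<Omega> (ev u) (\<phi> S))" if "\<phi> S \<in> L2 \<Omega>" for u S
    using that cinner_embed[of "ev u" "\<phi> S"] unfolding A_symmetric[symmetric]
    by (metis embed_ev ev_L2 l2.cinner_def complex.sel(1))
  have "\<exists>B. \<forall>w\<in>W. \<bar>inner u w\<bar> \<le> B" for u
  proof -
    have "compact (ev u ` closure \<Omega>)"
      using continuous_ev bounded_\<Omega> by (intro compact_continuous_image) auto
    then obtain B where B: "\<And>x. x \<in> closure \<Omega> \<Longrightarrow> cmod (ev u x) \<le> B"
      using compact_imp_bounded bounded_iff by (metis imageI)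
    have "\<bar>inner u (A (embed \<Omega> (\<phi> S)))\<bar> \<le> B" if S: "S \<in> sets ?P" "measure ?P S > 0" for S
    proof -
      have "S \<subseteq> closure \<Omega>"
        using sets.sets_into_space[OF S(1)] closure_subset[of \<Omega>] by auto
      then have "- B \<le> Re (ev u x)" "Re (ev u x) \<le> B" if "x \<in> S" for x
        using that B[of x] abs_Re_le_cmod[of "ev u x"] by force+
      note mean_value_bounds[OF S ev_L2 this, folded \<phi>_def]
      then show ?thesis using inner_eq[of S u] by simp
    qed
    then show ?thesis by (auto simp: W_def)
  qed
  then obtain C where C: "\<And>w. w \<in> W \<Longrightarrow> norm w \<le> C"
    using uniform_boundedness_inner[of W] by blast
  \<comment> \<open>If the bound failed at x, the real part of \<open>ev u\<close> would exceed the
    midpoint \<open>a\<close> on an open set around x. That set has positive measure, so its mean is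
    at least \<open>a\<close>, yet the members of \<open>W\<close> limit means to
    \<open>max C 0 * norm u\<close> < a. The maximum is taken because an empty \<open>W\<close>
    would allow a negative \<open>C\<close>.\<close>
  have Re_le: "Re (ev u x) \<le> max C 0 * norm u" if x: "x \<in> \<Omega>" for u x
  proof (rule ccontr)
    assume neg: "\<not> ?thesis"
    define a where "a = (Re (ev u x) + max C 0 * norm u) / 2"
    define S where "S = {y \<in> \<Omega>. a < Re (ev u y)}"
    have "open (\<Omega> \<inter> (\<lambda>y. Re (ev u y)) -` {a<..})"
      by (intro continuous_open_preimage continuous_intros continuous_ev_interior open_\<Omega>)
    moreover have "\<Omega> \<inter> (\<lambda>y. Re (ev u y)) -` {a<..} = S" by (auto simp: S_def)
    ultimately have "open S" by simp
    have "x \<in> S" using x neg by (auto simp: S_def a_def)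
    have "S \<subseteq> \<Omega>" by (auto simp: S_def)
    then have S: "S \<in> sets ?P" using \<open>open S\<close> by (simp add: sets_restrict_space_iff)
    have "\<not> negligible S" using \<open>open S\<close> \<open>x \<in> S\<close> open_not_negligible by blast
    then have "emeasure lebesgue S \<noteq> 0"
      using \<open>open S\<close> by (auto simp: negligible_iff_null_sets null_sets_def)
    moreover have "emeasure ?P S = emeasure lebesgue S"
      by (rule emeasure_restrict_space) (auto simp: S_def)
    ultimately have "measure ?P S \<noteq> 0" by (metis emeasure_eq_measure ennreal_0)
    then have pos: "measure ?P S > 0" by (simp add: zero_less_measure_iff)
    have "compact (ev u ` closure \<Omega>)"
      using continuous_ev bounded_\<Omega> by (intro compact_continuous_image) auto
    then obtain B where B: "\<And>x. x \<in> closure \<Omega> \<Longrightarrow> cmod (ev u x) \<le> B"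
      using compact_imp_bounded bounded_iff by (metis imageI)
    have "a \<le> Re (ev u y)" "Re (ev u y) \<le> B" if "y \<in> S" for y
      using that B[of y] closure_subset[of \<Omega>] complex_Re_le_cmod[of "ev u y"] by (force simp: S_def)+
    note \<phi> = mean_value_bounds[OF S pos ev_L2 this, folded \<phi>_def]
    have "a \<le> inner u (A (embed \<Omega> (\<phi> S)))" using inner_eq \<phi> by simp
    also have "\<dots> \<le> norm u * norm (A (embed \<Omega> (\<phi> S)))" by (rule norm_cauchy_schwarz)
    also have "\<dots> \<le> norm u * max C 0"
    proof -
      have "A (embed \<Omega> (\<phi> S)) \<in> W" unfolding W_def using S pos by blast
      then have "norm (A (embed \<Omega> (\<phi> S))) \<le> max C 0" by (intro max.coboundedI1 C)
      then show ?thesis by (intro mult_left_mono) auto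
    qed
    finally have "a \<le> max C 0 * norm u" by (simp add: mult.commute)
    then show False using neg by (simp add: a_def mult.commute[of "norm u"])
  qed
  have "cmod (ev u x) \<le> max C 0 * norm u" if x: "x \<in> \<Omega>" for u x
  proof (cases "ev u x = 0")
    case False
    \<comment> \<open>Rotating u by this unimodular number makes the value at x real and
      nonnegative, so the bound on real parts bounds the modulus.\<close>
    define c where "c = cnj (sgn (ev u x))"
    have "cmod c = 1" using False by (simp add: c_def norm_sgn)
    have "c * ev u x = ev u x * cnj (ev u x) / complex_of_real (cmod (ev u x))"
      by (simp add: c_def sgn_eq)
    also have "\<dots> = complex_of_real (cmod (ev u x))"
      unfolding complex_norm_square[symmetric] using False by (simp add: power2_eq_square)
    finally have "c * ev u x = complex_of_real (cmod (ev u x))" .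
    moreover have "x \<in> closure \<Omega>" using x closure_subset by blast
    ultimately have "cmod (ev u x) = Re (ev (l2.cscale c u) x)" by (simp only: ev_cscale Re_complex_of_real)
    also have "\<dots> \<le> max C 0 * norm u"
      using Re_le[OF x, of "l2.cscale c u"] \<open>cmod c = 1\<close> by simp
    finally show ?thesis .
  qed auto
  note interior = this
  have "cmod (ev u x) \<le> max C 0 * norm u" if x: "x \<in> closure \<Omega>" for u x
    by (rule continuous_le_on_closure[where f = "\<lambda>x. cmod (ev u x)", OF _ x interior])
      (intro continuous_on_norm continuous_ev)
  then show ?thesis by (intro exI[of _ "max C 0"]) auto
qed

section \<open>Representing vectors of the point evaluations and their continuity\<close>

definition kern :: "'a \<Rightarrow> 'a l2" where
  "kern x = (SOME k. \<forall>w. ev w x = l2.cinner w k)"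

lemma ev_eq_cinner:
  assumes "x \<in> closure \<Omega>" shows "ev w x = l2.cinner w (kern x)"
proof -
  obtain C where C: "\<And>w x. x \<in> closure \<Omega> \<Longrightarrow> cmod (ev w x) \<le> C * norm w" using ev_bounded by blast
  have "\<exists>k. \<forall>w. ev w x = l2.cinner w k"
    by (rule l2.riesz[of "\<lambda>w. ev w x" C, OF ev_add[OF assms] ev_cscale[OF assms] C[OF assms]]) blast
  then have "\<forall>w. ev w x = l2.cinner w (kern x)" unfolding kern_def by (rule someI_ex)
  then show ?thesis ..
qed

lemma kern_bounded:
  "\<exists>C\<ge>0. (\<forall>x\<in>closure \<Omega>. norm (kern x) \<le> C) \<and>
     (\<forall>x\<in>closure \<Omega>. \<forall>w. cmod (ev w x) \<le> C * norm w)"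
proof -
  obtain C where C: "C \<ge> 0" "\<And>w x. x \<in> closure \<Omega> \<Longrightarrow> cmod (ev w x) \<le> C * norm w"
    using ev_bounded by blast
  have "norm (kern x) \<le> C" if "x \<in> closure \<Omega>" for x
  proof (cases "kern x = 0")
    case False
    have "norm (kern x) * norm (kern x) = Re (ev (kern x) x)"
      by (simp add: ev_eq_cinner[OF that] l2.cinner_def power2_norm_eq_inner[symmetric] power2_eq_square)
    also have "\<dots> \<le> C * norm (kern x)"
      using C(2)[OF that, of "kern x"] complex_Re_le_cmod order_trans by blast
    finally show ?thesis using False by simp
  qed (use C in simp)
  then show ?thesis using C by blast
qed

text \<open>\<open>x \<mapsto> kern x\<close> is weakly continuous and bounded; \<open>T\<close> turns this into norm continuity.\<close>

lemma continuous_A_kern: "continuous_on (closure \<Omega>) (\<lambda>x. A (kern x))"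
  unfolding continuous_on_sequentially
proof (intro allI ballI impI)
  fix X a assume a: "a \<in> closure \<Omega>" and "(\<forall>n. X n \<in> closure \<Omega>) \<and> X \<longlonglongrightarrow> a"
  then have X: "\<And>n. X n \<in> closure \<Omega>" "X \<longlonglongrightarrow> a" by auto
  interpret finite_measure "lebesgue_on \<Omega>" by (rule finite_measure_\<Omega>)
  obtain C where C: "C \<ge> 0" "\<And>x. x \<in> closure \<Omega> \<Longrightarrow> norm (kern x) \<le> C"
    "\<And>w x. x \<in> closure \<Omega> \<Longrightarrow> cmod (ev w x) \<le> C * norm w" using kern_bounded by blast
  define d where "d n = ev (kern (X n) - kern a)" for n
  have "(\<lambda>n. LINT y|lebesgue_on \<Omega>. (cmod (d n y))\<^sup>2) \<longlonglongrightarrow> (LINT y|lebesgue_on \<Omega>. 0)"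
  \<comment> \<open>One factor \<open>C\<close> bounds point evaluation, and \<open>C + C\<close>
    bounds the norm of the difference of two representing vectors.\<close>
  proof (rule integral_dominated_convergence[where w = "\<lambda>_. (C * (C + C))\<^sup>2"])
    show "AE y in lebesgue_on \<Omega>. (\<lambda>n. (cmod (d n y))\<^sup>2) \<longlonglongrightarrow> 0"
    proof (rule AE_I2)
      fix y assume "y \<in> space (lebesgue_on \<Omega>)"
      then have y: "y \<in> closure \<Omega>" using closure_subset by auto
      \<comment> \<open>Symmetry of (k_x, k_y) exchanges the two points: the sequence now moves the
        argument of the fixed continuous function \<open>ev (kern y)\<close>.\<close>
      have "d n y = cnj (ev (kern y) (X n)) - cnj (ev (kern y) a)" for n
        unfolding d_def ev_eq_cinner[OF y] ev_eq_cinner[OF X(1)] ev_eq_cinner[OF a]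
        by (simp add: l2.cinner_algebra l2.cinner_commute[of "kern y"])
      moreover have "(\<lambda>n. ev (kern y) (X n)) \<longlonglongrightarrow> ev (kern y) a"
        using continuous_on_tendsto_compose[OF continuous_ev X(2) a] X(1) by simp
      then have "(\<lambda>n. (cmod (cnj (ev (kern y) (X n)) - cnj (ev (kern y) a)))\<^sup>2) \<longlonglongrightarrow> (cmod (cnj (ev (kern y) a) - cnj (ev (kern y) a)))\<^sup>2"
        by (intro tendsto_intros)
      ultimately show "(\<lambda>n. (cmod (d n y))\<^sup>2) \<longlonglongrightarrow> 0" by simp
    qed
    show "AE y in lebesgue_on \<Omega>. norm ((cmod (d n y))\<^sup>2) \<le> (C * (C + C))\<^sup>2" for n
    proof (rule AE_I2)
      fix y assume "y \<in> space (lebesgue_on \<Omega>)"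
      then have y: "y \<in> closure \<Omega>" using closure_subset by auto
      have "norm (kern (X n) - kern a) \<le> C + C"
        using norm_triangle_ineq4[of "kern (X n)" "kern a"] C(2)[OF X(1), of n] C(2)[OF a] by linarith
      then have "cmod (d n y) \<le> C * (C + C)"
        unfolding d_def by (rule order_trans[OF C(3)[OF y] mult_left_mono[OF _ C(1)]])
      then show "norm ((cmod (d n y))\<^sup>2) \<le> (C * (C + C))\<^sup>2" by (simp add: power_mono)
    qed
  qed (auto simp: d_def)
  then have "(\<lambda>n. sqrt (LINT y|lebesgue_on \<Omega>. (cmod (d n y))\<^sup>2)) \<longlonglongrightarrow> sqrt (LINT y|lebesgue_on \<Omega>. 0)"
    by (rule tendsto_real_sqrt)
  moreover have "sqrt (LINT y|lebesgue_on \<Omega>. (cmod (d n y))\<^sup>2) = norm (embed \<Omega> (d n))" for n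
    by (simp add: d_def norm_embed l2_norm_def)
  ultimately have "(\<lambda>n. norm (embed \<Omega> (d n))) \<longlonglongrightarrow> 0" by simp
  then have "(\<lambda>n. A (kern (X n)) - A (kern a)) \<longlonglongrightarrow> 0"
    unfolding d_def embed_ev l2.clinearD(2)[OF pos.clinear_T] by (rule tendsto_norm_zero_cancel)
  then show "((\<lambda>x. A (kern x)) \<circ> X) \<longlonglongrightarrow> A (kern a)" by (simp add: o_def LIM_zero_cancel)
qed

text \<open>Moving x changes the value by at most C |g x - g a|, uniformly in y; moving y then
  concerns the single continuous function \<open>ev (g a)\<close>.\<close>

lemma continuous_ev_pair:
  assumes g: "continuous_on (closure \<Omega>) g"
  shows "continuous_on (closure \<Omega> \<times> closure \<Omega>) (\<lambda>(x, y). ev (g x) y)"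
  unfolding continuous_on_sequentially
proof (intro allI ballI impI)
  fix X p assume p: "p \<in> closure \<Omega> \<times> closure \<Omega>"
    and X: "(\<forall>n. X n \<in> closure \<Omega> \<times> closure \<Omega>) \<and> X \<longlonglongrightarrow> p"
  obtain a b where ab: "p = (a, b)" "a \<in> closure \<Omega>" "b \<in> closure \<Omega>" using p by auto
  have mem: "fst (X n) \<in> closure \<Omega>" "snd (X n) \<in> closure \<Omega>" for n using X by (auto simp: mem_Times_iff)
  have "X \<longlonglongrightarrow> p" using X by blast
  from tendsto_fst[OF this] tendsto_snd[OF this]
  have lim: "(\<lambda>n. fst (X n)) \<longlonglongrightarrow> a" "(\<lambda>n. snd (X n)) \<longlonglongrightarrow> b"
    by (simp_all add: ab)
  obtain C where C: "C \<ge> 0" "\<And>w x. x \<in> closure \<Omega> \<Longrightarrow> cmod (ev w x) \<le> C * norm w"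
    using ev_bounded by blast
  have "(\<lambda>n. g (fst (X n))) \<longlonglongrightarrow> g a"
    by (rule continuous_on_tendsto_compose[OF g lim(1) ab(2)]) (simp add: mem)
  then have "(\<lambda>n. C * norm (g (fst (X n)) - g a)) \<longlonglongrightarrow> 0"
    by (intro tendsto_mult_right_zero tendsto_norm_zero LIM_zero)
  moreover have "cmod (ev (g (fst (X n)) - g a) (snd (X n))) \<le> C * norm (g (fst (X n)) - g a)" for n
    by (rule C(2)[OF mem(2)])
  ultimately have "(\<lambda>n. ev (g (fst (X n)) - g a) (snd (X n))) \<longlonglongrightarrow> 0"
    by (rule Lim_null_comparison[rotated, OF _ always_eventually[OF allI]])
  moreover have "(\<lambda>n. ev (g a) (snd (X n))) \<longlonglongrightarrow> ev (g a) b"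
    by (rule continuous_on_tendsto_compose[OF continuous_ev lim(2) ab(3)]) (simp add: mem)
  ultimately have "(\<lambda>n. ev (g (fst (X n)) - g a) (snd (X n)) + ev (g a) (snd (X n))) \<longlonglongrightarrow> 0 + ev (g a) b"
    by (rule tendsto_add)
  moreover have "ev (g (fst (X n)) - g a) (snd (X n)) + ev (g a) (snd (X n)) = ev (g (fst (X n))) (snd (X n))" for n
    by (subst ev_diff[OF mem(2)]) simp
  ultimately show "((\<lambda>(x, y). ev (g x) y) \<circ> X) \<longlonglongrightarrow> (case p of (x, y) \<Rightarrow> ev (g x) y)"
    by (simp add: o_def case_prod_beta ab)
qed

section \<open>Existence and uniqueness for the functional calculus\<close>

lemma is_fun_calc_exists:
  assumes "l2.clinear B" and e: "e \<longlonglongrightarrow> 0"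
    and B: "\<And>n u. norm (l2.polyop (p n) A u - B u) \<le> e n * norm u"
    and f: "uniform_limit (op_spectrum \<Omega> T) (\<lambda>n. poly (p n)) f sequentially"
    and range_B: "\<And>u. B u \<in> embed \<Omega> ` L2 \<Omega>"
  shows "is_fun_calc \<Omega> T f (\<lambda>u. rep_l2 (B (embed \<Omega> u)))"
  unfolding is_fun_calc_def
proof (intro conjI exI[of _ p])
  let ?D = "\<lambda>n u x. poly_op (p n) T u x - rep_l2 (B (embed \<Omega> u)) x"
  have "l2_norm \<Omega> (?D n u) \<le> \<bar>e n\<bar> * l2_norm \<Omega> u" if u: "u \<in> L2 \<Omega>" for n u
  proof -
    have D: "?D n u \<in> L2 \<Omega>" by (intro L2_diff poly_op_embed[OF bounded_T u] rep_L2)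
    obtain w where w: "w \<in> L2 \<Omega>" "B (embed \<Omega> u) = embed \<Omega> w"
      using range_B[of "embed \<Omega> u"] by blast
    have "embed \<Omega> (?D n u) = l2.polyop (p n) A (embed \<Omega> u) - B (embed \<Omega> u)"
      using w by (simp add: embed_diff poly_op_embed[OF bounded_T u] embed_rep_embed)
    then have "l2_norm \<Omega> (?D n u) = norm (l2.polyop (p n) A (embed \<Omega> u) - B (embed \<Omega> u))"
      using norm_embed[OF D] by simp
    also have "\<dots> \<le> e n * norm (embed \<Omega> u)" by (rule B)
    also have "\<dots> \<le> \<bar>e n\<bar> * norm (embed \<Omega> u)" by (intro mult_right_mono) auto
    finally show ?thesis by (simp add: norm_embed[OF u])
  qed
  note bound = this
  have "norm (op_norm \<Omega> (?D n)) \<le> \<bar>e n\<bar>" for n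
    using op_norm_le[of "\<bar>e n\<bar>" "?D n", OF abs_ge_zero bound] by simp
  then show "(\<lambda>n. op_norm \<Omega> (?D n)) \<longlonglongrightarrow> 0"
    by (rule Lim_null_comparison[OF always_eventually[OF allI] tendsto_rabs_zero[OF e]])
  show "bounded_op \<Omega> (\<lambda>u. rep_l2 (B (embed \<Omega> u)))"
    by (rule bounded_op_of_clinear[OF assms(1)])
qed (rule f)

lemma is_fun_calc_unique:
  assumes S: "is_fun_calc \<Omega> T f S" and "l2.clinear B" and e: "e \<longlonglongrightarrow> 0"
    and B: "\<And>n u. norm (l2.polyop (p n) A u - B u) \<le> e n * norm u"
    and f: "uniform_limit (op_spectrum \<Omega> T) (\<lambda>n. poly (p n)) f sequentially"
    and u: "u \<in> L2 \<Omega>"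
  shows "embed \<Omega> (S u) = B (embed \<Omega> u)"
proof -
  obtain q where bounded_S: "bounded_op \<Omega> S"
    and q: "uniform_limit (op_spectrum \<Omega> T) (\<lambda>n. poly (q n)) f sequentially"
    and lim: "(\<lambda>n. op_norm \<Omega> (\<lambda>u x. poly_op (q n) T u x - S u x)) \<longlonglongrightarrow> 0"
    using S by (auto simp: is_fun_calc_def)
  let ?w = "embed \<Omega> u"
  have 1: "(\<lambda>n. l2.polyop (q n) A ?w) \<longlonglongrightarrow> embed \<Omega> (S u)"
  proof -
    have "norm (l2.polyop (q n) A ?w - embed \<Omega> (S u))
        \<le> op_norm \<Omega> (\<lambda>u x. poly_op (q n) T u x - S u x) * norm ?w" for n
    proof -
      let ?D = "\<lambda>u x. poly_op (q n) T u x - S u x"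
      let ?L = "\<lambda>w. l2.polyop (q n) A w - lift_op \<Omega> S w"
      have D: "?D v \<in> L2 \<Omega>" "embed \<Omega> (?D v) = ?L (embed \<Omega> v)" if "v \<in> L2 \<Omega>" for v
        using that by (simp_all add: L2_diff embed_diff poly_op_embed[OF bounded_T]
            bounded_opD[OF bounded_S] lift_op_embed[OF bounded_S])
      have "bounded_linear ?L"
        by (intro l2.clinearD(7) l2.clinear_diff l2.clinear_polyop pos.clinear_T clinear_lift_op bounded_S)
      then obtain K where K: "K > 0" "\<And>w. norm (?L w) \<le> norm w * K"
        using bounded_linear.pos_bounded by blast
      \<comment> \<open>An a priori bound, so that \<open>op_norm\<close> really is an operator norm
        here.\<close>
      have "l2_norm \<Omega> (?D v) \<le> K * l2_norm \<Omega> v" if "v \<in> L2 \<Omega>" for v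
        using K(2)[of "embed \<Omega> v"] D[OF that] norm_embed[OF D(1)[OF that]] norm_embed[OF that]
        by (simp add: mult.commute)
      then have "l2_norm \<Omega> (?D u) \<le> op_norm \<Omega> ?D * l2_norm \<Omega> u"
        using K(1) u by (intro le_op_norm[where C = K]) auto
      then show ?thesis
        using D[OF u] norm_embed[OF D(1)[OF u]] norm_embed[OF u] lift_op_embed[OF bounded_S u] by simp
    qed
    then have "(\<lambda>n. l2.polyop (q n) A ?w - embed \<Omega> (S u)) \<longlonglongrightarrow> 0"
      by (rule Lim_null_comparison[OF always_eventually[OF allI]]) (intro tendsto_mult_left_zero lim)
    then show ?thesis by (rule LIM_zero_cancel)
  qed
  have 2: "(\<lambda>n. l2.polyop (p n) A ?w) \<longlonglongrightarrow> B ?w"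
  proof -
    have "(\<lambda>n. l2.polyop (p n) A ?w - B ?w) \<longlonglongrightarrow> 0"
      by (rule Lim_null_comparison[OF always_eventually[OF allI[OF B]]]) (intro tendsto_mult_left_zero e)
    then show ?thesis by (rule LIM_zero_cancel)
  qed
  \<comment> \<open>Both sequences tend to f uniformly on the spectrum, so their difference tends to
    0 there, and hence also as operators on functions on \<Omega>.\<close>
  have "(\<lambda>n. l2.polyop (q n - p n) A ?w) \<longlonglongrightarrow> 0"
  proof (rule metric_LIMSEQ_I)
    fix r :: real assume "0 < r"
    \<comment> \<open>Adding 1 allows division even for the zero vector. Two errors below r / (2 N)
      each, times a norm below N, stay below r.\<close>
    define N where "N = norm ?w + 1"
    have "N > 0" "norm ?w < N" by (simp_all add: N_def add_nonneg_pos)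
    define d where "d = r / (2 * N)"
    have "d > 0" using \<open>0 < r\<close> \<open>N > 0\<close> by (simp add: d_def)
    have "\<forall>\<^sub>F n in sequentially. \<forall>z\<in>op_spectrum \<Omega> T. dist (poly (q n) z) (f z) < d"
      "\<forall>\<^sub>F n in sequentially. \<forall>z\<in>op_spectrum \<Omega> T. dist (poly (p n) z) (f z) < d"
      using q f \<open>d > 0\<close> by (auto simp: uniform_limit_iff)
    then have "\<forall>\<^sub>F n in sequentially. dist (l2.polyop (q n - p n) A ?w) 0 < r"
    proof eventually_elim
      case (elim n)
      have "cmod (poly (q n - p n) z) \<le> 2 * d" if "z \<in> op_spectrum \<Omega> T" for z
        using elim that dist_triangle_less_add[of "poly (q n) z" "f z" d "poly (p n) z" d]
        by (simp add: dist_norm dist_commute less_imp_le)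
      then have "norm (l2.polyop (q n - p n) A ?w) \<le> 2 * d * norm ?w"
        using u \<open>d > 0\<close> by (intro polyop_le_spectrum) auto
      also have "2 * d * norm ?w < r"
      proof -
        have "2 * d * norm ?w = r * (norm ?w / N)" by (simp add: d_def)
        also have "\<dots> < r * 1"
          using \<open>0 < r\<close> \<open>N > 0\<close> \<open>norm ?w < N\<close> by (intro mult_strict_left_mono) auto
        finally show ?thesis by simp
      qed
      finally show ?case by simp
    qed
    then show "\<exists>N. \<forall>n\<ge>N. dist (l2.polyop (q n - p n) A ?w) 0 < r"
      by (simp add: eventually_sequentially)
  qed
  from tendsto_diff[OF 1 this] have "(\<lambda>n. l2.polyop (p n) A ?w) \<longlonglongrightarrow> embed \<Omega> (S u)"
    by (simp add: l2.polyop_diff)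
  then show ?thesis using 2 by (rule LIMSEQ_unique)
qed

section \<open>The continuous kernel of T^(2+\<epsilon>)\<close>

lemma powr_kernel:
  assumes \<epsilon>: "\<epsilon> > 0"
  shows "\<exists>K. continuous_on (closure \<Omega> \<times> closure \<Omega>) K \<and>
           (\<forall>u\<in>L2 \<Omega>. in_C \<Omega> (op_powr \<Omega> T (2 + \<epsilon>) u) \<and>
              (\<forall>x\<in>closure \<Omega>. cont_rep \<Omega> (op_powr \<Omega> T (2 + \<epsilon>) u) x
                 = (LINT y|lebesgue_on \<Omega>. K (x, y) * u y)))"
proof -
  obtain q :: "nat \<Rightarrow> complex poly" where q0: "\<And>n. poly (q n) 0 = 0" and cnj_q: "\<And>n. map_poly cnj (q n) = q n"
    and q: "\<And>n t. t \<in> {0..M} \<Longrightarrow>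
       cmod (poly (q n) (complex_of_real t) - complex_of_real (t powr \<epsilon>)) \<le> 1 / real (Suc n)"
    by (rule weierstrass_powr[OF \<epsilon>, of M]) blast
  have rate: "(\<lambda>n. c * (1 / real (Suc n))) \<longlonglongrightarrow> 0" for c
    by (intro tendsto_mult_right_zero LIMSEQ_Suc lim_1_over_n)
  have rate': "\<forall>\<^sub>F n in sequentially. c * (1 / real (Suc n)) < r" if "r > 0" for r c
    using order_tendstoD(2)[OF rate that] .
  have "uniformly_convergent_on {0..M} (\<lambda>n t. poly (q n) (complex_of_real t))"
    unfolding uniformly_convergent_on_def
  proof (intro exI uniform_limitI)
    fix r :: real assume "0 < r"
    from rate'[OF this, of 1]
    show "\<forall>\<^sub>F n in sequentially. \<forall>t\<in>{0..M}.
        dist (poly (q n) (complex_of_real t)) (complex_of_real (t powr \<epsilon>)) < r"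
    proof eventually_elim
      case (elim n)
      show ?case
      proof
        fix t assume "t \<in> {0..M}"
        from q[OF this, of n] elim
        show "dist (poly (q n) (complex_of_real t)) (complex_of_real (t powr \<epsilon>)) < r"
          by (simp add: dist_norm)
      qed
    qed
  qed
  then obtain G e where G: "l2.clinear G" and e: "e \<longlonglongrightarrow> 0"
    and Ge: "\<And>n u. norm (l2.polyop (q n) A u - G u) \<le> e n * norm u"
    by (rule pos.functional_calculus) blast
  note A = l2.clinearD[OF pos.clinear_T]
  have G_limit: "(\<lambda>n. l2.polyop (q n) A u) \<longlonglongrightarrow> G u" for u
  proof -
    have "(\<lambda>n. l2.polyop (q n) A u - G u) \<longlonglongrightarrow> 0"
      by (rule Lim_null_comparison[OF always_eventually[OF allI[OF Ge]]]) (intro tendsto_mult_left_zero e)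
    then show ?thesis by (rule LIM_zero_cancel)
  qed
  have G_symmetric: "inner (G u) v = inner u (G v)" for u v
  proof (rule LIMSEQ_unique)
    show "(\<lambda>n. inner (l2.polyop (q n) A u) v) \<longlonglongrightarrow> inner (G u) v"
      by (rule tendsto_inner[OF G_limit tendsto_const])
    have "inner (l2.polyop (q n) A u) v = inner u (l2.polyop (q n) A v)" for n
      using l2.polyop_adjoint[OF pos.clinear_T A_symmetric, of "q n" u v] by (simp only: cnj_q)
    then show "(\<lambda>n. inner (l2.polyop (q n) A u) v) \<longlonglongrightarrow> inner u (G v)"
      using tendsto_inner[OF tendsto_const G_limit] by simp
  qed
  define B where "B = (\<lambda>u. A (G (A u)))"
  have B: "l2.clinear B"
    unfolding B_def by (rule l2.clinear_compose[OF pos.clinear_T l2.clinear_compose[OF G pos.clinear_T]])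
  \<comment> \<open>This is X^2 times \<open>q n\<close>; the two factors T are placed on either
    side of q(T), as in \<open>B\<close>.\<close>
  define p where "p n = pCons 0 (pCons 0 (q n))" for n
  have p: "l2.polyop (p n) A u = A (l2.polyop (q n) A (A u))" for n u
    by (simp add: p_def l2.polyop_pCons[OF pos.clinear_T] l2.polyop_commute[OF pos.clinear_T])
  have pB: "norm (l2.polyop (p n) A u - B u) \<le> (M * \<bar>e n\<bar> * M) * norm u" for n u
  proof -
    have "norm (l2.polyop (p n) A u - B u) = norm (A (l2.polyop (q n) A (A u) - G (A u)))"
      by (simp only: p B_def A(2))
    also have "\<dots> \<le> M * (e n * norm (A u))"
      using M by (intro order_trans[OF pos.T_bound] mult_left_mono Ge) auto
    also have "\<dots> \<le> M * (\<bar>e n\<bar> * (M * norm u))"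
      using M by (intro mult_left_mono mult_mono pos.T_bound) auto
    finally show ?thesis by (simp add: mult_ac)
  qed
  have e': "(\<lambda>n. M * \<bar>e n\<bar> * M) \<longlonglongrightarrow> 0"
    by (rule tendsto_mult_left_zero[OF tendsto_mult_right_zero[OF tendsto_rabs_zero[OF e]]])
  let ?f = "\<lambda>z. complex_of_real (Re z powr (2 + \<epsilon>))"
  have f: "uniform_limit (op_spectrum \<Omega> T) (\<lambda>n. poly (p n)) ?f sequentially"
  proof (rule uniform_limitI)
    fix r :: real assume "0 < r"
    \<comment> \<open>Multiplication by t^2 \<le> M^2 enlarges the error 1 / (n + 1) of
      \<open>q n\<close> at most by this factor.\<close>
    from rate'[OF this, of "M\<^sup>2"]
    show "\<forall>\<^sub>F n in sequentially. \<forall>z\<in>op_spectrum \<Omega> T. dist (poly (p n) z) (?f z) < r"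
    proof eventually_elim
      case (elim n)
      show ?case
      proof
        fix z assume "z \<in> op_spectrum \<Omega> T"
        then obtain t where t: "t \<in> {0..M}" "z = complex_of_real t" using spectrum_subset by blast
        have "t powr (2 + \<epsilon>) = t\<^sup>2 * t powr \<epsilon>"
          using t by (cases "t = 0") (auto simp: powr_add)
        then have "poly (p n) z - ?f z = (complex_of_real t)\<^sup>2 * (poly (q n) (complex_of_real t) - complex_of_real (t powr \<epsilon>))"
          by (simp add: p_def t power2_eq_square algebra_simps)
        then have "dist (poly (p n) z) (?f z) = t\<^sup>2 * cmod (poly (q n) (complex_of_real t) - complex_of_real (t powr \<epsilon>))"
          by (simp add: dist_norm norm_mult norm_power)
        also have "\<dots> \<le> M\<^sup>2 * (1 / real (Suc n))"
          using t by (intro mult_mono q power_mono) auto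
        finally show "dist (poly (p n) z) (?f z) < r" using elim by simp
      qed
    qed
  qed
  have "is_fun_calc \<Omega> T ?f (\<lambda>u. rep_l2 (B (embed \<Omega> u)))"
    by (rule is_fun_calc_exists[OF B e' pB f]) (simp add: B_def dom.T_V lift_op_def bounded_opD[OF bounded_T])
  \<comment> \<open>Having exhibited one operator with the defining property, the choice behind
    \<open>op_powr\<close> has it as well.\<close>
  then have powr: "is_fun_calc \<Omega> T ?f (op_powr \<Omega> T (2 + \<epsilon>))"
    unfolding op_powr_def fun_calc_def by (rule someI[where P = "is_fun_calc \<Omega> T ?f"])
  then have bounded_powr: "bounded_op \<Omega> (op_powr \<Omega> T (2 + \<epsilon>))" by (simp add: is_fun_calc_def)
  have rep: "is_cont_rep \<Omega> (op_powr \<Omega> T (2 + \<epsilon>) u) (ev (G (A (embed \<Omega> u))))" if u: "u \<in> L2 \<Omega>" for u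
  proof -
    have "embed \<Omega> (op_powr \<Omega> T (2 + \<epsilon>) u) = embed \<Omega> (ev (G (A (embed \<Omega> u))))"
      using is_fun_calc_unique[OF powr B e' pB f u] by (simp add: embed_ev B_def)
    then show ?thesis
      by (simp add: is_cont_rep_def continuous_ev embed_eq_iff[OF bounded_opD(1)[OF bounded_powr u] ev_L2])
  qed
  have continuous_G_kern: "continuous_on (closure \<Omega>) (\<lambda>x. G (kern x))"
  proof (rule uniform_limit_theorem)
    obtain C where C: "C \<ge> 0" "\<And>x. x \<in> closure \<Omega> \<Longrightarrow> norm (kern x) \<le> C" using kern_bounded by blast
    show "uniform_limit (closure \<Omega>) (\<lambda>n x. l2.polyop (q n) A (kern x)) (\<lambda>x. G (kern x)) sequentially"
    proof (rule uniform_limitI)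
      fix r :: real assume "0 < r"
      have "(\<lambda>n. \<bar>e n\<bar> * C) \<longlonglongrightarrow> 0" by (intro tendsto_mult_left_zero tendsto_rabs_zero e)
      from order_tendstoD(2)[OF this \<open>0 < r\<close>]
      show "\<forall>\<^sub>F n in sequentially. \<forall>x\<in>closure \<Omega>. dist (l2.polyop (q n) A (kern x)) (G (kern x)) < r"
      proof eventually_elim
        case (elim n)
        show ?case
        proof
          fix x assume "x \<in> closure \<Omega>"
          then have "e n * norm (kern x) \<le> \<bar>e n\<bar> * C" using C by (intro mult_mono) auto
          then show "dist (l2.polyop (q n) A (kern x)) (G (kern x)) < r"
            using Ge[of n "kern x"] elim by (simp add: dist_norm)
        qed
      qed
    qed
    show "\<forall>\<^sub>F n in sequentially. continuous_on (closure \<Omega>) (\<lambda>x. l2.polyop (q n) A (kern x))"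
    proof (rule always_eventually, rule allI)
      fix n
      \<comment> \<open>The constant term is 0, so q(T) k_x = r(T) (T k_x), and T k_x is already
        norm continuous in x.\<close>
      obtain a r where ar: "q n = pCons a r" by (cases "q n")
      have "q n = pCons 0 r" using q0[of n] by (simp add: ar)
      then have "l2.polyop (q n) A u = l2.polyop r A (A u)" for u
        by (simp add: l2.polyop_pCons[OF pos.clinear_T] l2.polyop_commute[OF pos.clinear_T])
      moreover have "continuous_on (closure \<Omega>) (\<lambda>x. l2.polyop r A (A (kern x)))"
        by (rule bounded_linear.continuous_on[OF _ continuous_A_kern])
          (intro l2.clinearD(7) l2.clinear_polyop pos.clinear_T)
      ultimately show "continuous_on (closure \<Omega>) (\<lambda>x. l2.polyop (q n) A (kern x))"
        by simp
    qed
  qed simp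
  \<comment> \<open>The conjugate compensates for the second argument of \<open>l2_inner\<close>,
    where the function \<open>ev (G (kern x))\<close> representing T T^\<epsilon> k_x will
    stand.\<close>
  define K where "K = (\<lambda>(x, y). cnj (ev (G (kern x)) y))"
  have "K = (\<lambda>p. cnj ((\<lambda>(x, y). ev (G (kern x)) y) p))" by (auto simp: K_def)
  then have "continuous_on (closure \<Omega> \<times> closure \<Omega>) K"
    using continuous_on_cnj[OF continuous_ev_pair[OF continuous_G_kern]] by simp
  moreover have "cont_rep \<Omega> (op_powr \<Omega> T (2 + \<epsilon>) u) x = (LINT y|lebesgue_on \<Omega>. K (x, y) * u y)"
    if u: "u \<in> L2 \<Omega>" and x: "x \<in> closure \<Omega>" for u x
  proof -
    have "is_cont_rep \<Omega> (op_powr \<Omega> T (2 + \<epsilon>) u) (cont_rep \<Omega> (op_powr \<Omega> T (2 + \<epsilon>) u))"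
      unfolding cont_rep_def using rep[OF u] by (rule someI[where P = "is_cont_rep \<Omega> _"])
    then have "cont_rep \<Omega> (op_powr \<Omega> T (2 + \<epsilon>) u) x = ev (G (A (embed \<Omega> u))) x"
      using is_cont_rep_unique[OF open_\<Omega> _ rep[OF u] x] by blast
    also have "\<dots> = l2.cinner (embed \<Omega> u) (A (G (kern x)))"
      by (simp add: ev_eq_cinner[OF x] l2.cinner_symmetric[OF G G_symmetric]
          l2.cinner_symmetric[OF pos.clinear_T A_symmetric])
    also have "\<dots> = l2_inner \<Omega> u (ev (G (kern x)))"
      by (simp add: embed_ev[symmetric] cinner_embed u)
    also have "\<dots> = (LINT y|lebesgue_on \<Omega>. K (x, y) * u y)"
      by (simp add: l2_inner_def K_def mult.commute)
    finally show ?thesis .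
  qed
  moreover have "in_C \<Omega> (op_powr \<Omega> T (2 + \<epsilon>) u)" if "u \<in> L2 \<Omega>" for u
    unfolding in_C_def using rep[OF that] by blast
  ultimately show ?thesis by (intro exI[of _ K]) simp
qed

end

theorem theorem4p1:
  fixes \<Omega> :: "(real ^ 'd) set" and T :: "(real ^ 'd) oper"
  assumes "open \<Omega>" and "bounded \<Omega>"
    and "bounded_op \<Omega> T" and "positive_op \<Omega> T"
    and "\<forall>u\<in>L2 \<Omega>. in_C \<Omega> (T u)"
  shows "\<forall>\<epsilon>::real. \<epsilon> > 0 \<longrightarrow> (\<exists>K :: (real ^ 'd) \<times> (real ^ 'd) \<Rightarrow> complex.
           continuous_on (closure \<Omega> \<times> closure \<Omega>) K \<and>
           (\<forall>u\<in>L2 \<Omega>. in_C \<Omega> (op_powr \<Omega> T (2 + \<epsilon>) u) \<and>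
              (\<forall>x\<in>closure \<Omega>. cont_rep \<Omega> (op_powr \<Omega> T (2 + \<epsilon>) u) x
                 = (LINT y|lebesgue_on \<Omega>. K (x, y) * u y))))"
proof -
  interpret lebesgue_domain \<Omega>
    using assms(1) by unfold_locales simp
  obtain M where M: "M > 0" "\<And>u. u \<in> L2 \<Omega> \<Longrightarrow> l2_norm \<Omega> (T u) \<le> M * l2_norm \<Omega> u"
    using bounded_op_bound[OF assms(3)] by blast
  interpret smoothing_operator \<Omega> T M
    by unfold_locales (use assms M in auto)
  show ?thesis by (intro allI impI powr_kernel)
qed

end
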